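(* Let $T>0$, $m\in\mathbb{N}$, $p\in(1,\infty)$, $\alpha\in(1/p,1)$, and let $G:[0,T]\times\mathbb{R}^m\to\mathbb{R}^m$ be a Carathéodory map such that $$\|G(t,x)\|_m\le\gamma(t)+C\|x\|_m$$ for some $\gamma\in L^p(0,T)$ and some constant $C$. Assume that $G$ is locally Lipschitz continuous in the second variable for almost every $t\in[0,T]$. Then, for $u_0\in\mathbb{R}^m$, the problem $$cD_t^\alpha u(t)=G(t,u(t))\ \text{ for a.e. }t\in[0,T],\qquad u(0)=u_0,$$ has a unique global solution in $[0,T]$.
   Context: $\|\cdot\|_m$ is a norm on $\mathbb{R}^m$. A map $G:[0,T]\times\mathbb{R}^m\to\mathbb{R}^m$ is a Carathéodory map if $G(\cdot,x)$ is measurable for each $x\in\mathbb{R}^m$ and $G(t,\cdot)$ is continuous for almost every $t\in[0,T]$. $G$ is locally Lipschitz continuous in the second variable for almost every $t$ if for each $x_0\in\mathbb{R}^m$ there exist $r=r(x_0)>0$ and $L=L(x_0)\ge0$ such that $\|G(t,x)-G(t,y)\|_m\le L\|x-y\|_m$ for all $x,y\in B_r(x_0)$ (open ball) and almost every $t\in[0,T]$. For $\beta>0$, $J_t^\beta v(t)=\frac{1}{\Gamma(\beta)}\int_0^t(t-s)^{\beta-1}v(s)\,ds$. For $\alpha\in(0,1)$ and $v\in C([0,T];\mathbb{R}^m)$ with $J_t^{1-\alpha}v\in W^{1,1}(0,T;\mathbb{R}^m)$, the Caputo derivative is $cD_t^\alpha v(t)=\frac{d}{dt}\big[J_t^{1-\alpha}(v(t)-v(0))\big]$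 for a.e. $t$. A global solution in $[0,T]$ is a continuous function $\phi:[0,T]\to\mathbb{R}^m$ (for which the Caputo derivative is defined) satisfying both equations of the problem on $[0,T]$. *)

theory Defs
  imports "HOL-Analysis.Analysis"
begin

text \<open>
  Functions on \<open>[0,T]\<close> are total functions on \<open>real\<close> whose values outside \<open>[0,T]\<close> are irrelevant.
  Measurability and ``almost everywhere'' refer to Lebesgue measure.
\<close>

definition is_norm :: "('a::real_vector \<Rightarrow> real) \<Rightarrow> bool" where
  "is_norm N \<longleftrightarrow>
     (\<forall>x. 0 \<le> N x) \<and>
     (\<forall>x. N x = 0 \<longleftrightarrow> x = 0) \<and>
     (\<forall>c x. N (c *\<^sub>R x) = \<bar>c\<bar> * N x) \<and>
     (\<forall>x y. N (x + y) \<le> N x + N y)"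

definition in_Lp :: "real \<Rightarrow> real \<Rightarrow> (real \<Rightarrow> real) \<Rightarrow> bool" where
  "in_Lp p T g \<longleftrightarrow>
     g \<in> borel_measurable (lebesgue_on {0<..<T}) \<and>
     integrable (lebesgue_on {0<..<T}) (\<lambda>t. \<bar>g t\<bar> powr p)"

definition caratheodory :: "real \<Rightarrow> (real \<Rightarrow> real^'m \<Rightarrow> real^'m) \<Rightarrow> bool" where
  "caratheodory T G \<longleftrightarrow>
     (\<forall>x. (\<lambda>t. G t x) \<in> borel_measurable (lebesgue_on {0..T})) \<and>
     (AE t in lebesgue_on {0..T}. continuous_on UNIV (G t))"

definition locally_lipschitz_ae ::
  "(real^'m \<Rightarrow> real) \<Rightarrow> real \<Rightarrow> (real \<Rightarrow> real^'m \<Rightarrow> real^'m) \<Rightarrow> bool" where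
  "locally_lipschitz_ae N T G \<longleftrightarrow>
     (\<forall>x0. \<exists>r>0. \<exists>L\<ge>0. \<forall>x y. N (x - x0) < r \<longrightarrow> N (y - x0) < r \<longrightarrow>
        (AE t in lebesgue_on {0..T}. N (G t x - G t y) \<le> L * N (x - y)))"

text \<open>
  \<open>rl_integral \<beta> v t\<close> is \<open>J\<^sub>t\<^sup>\<beta> v(t)\<close>.  The convention \<open>0 powr a = 0\<close> only affects the
  integrand at \<open>s = t\<close>.
\<close>

definition rl_integral :: "real \<Rightarrow> (real \<Rightarrow> real^'m) \<Rightarrow> real \<Rightarrow> real^'m" where
  "rl_integral \<beta> v t =
     (1 / Gamma \<beta>) *\<^sub>R (LINT s|lebesgue_on {0..t}. (t - s) powr (\<beta> - 1) *\<^sub>R v s)"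

text \<open>
  The space \<open>W\<^sup>1\<^sup>,\<^sup>1(0,T;\<real>\<^sup>m)\<close> is defined through weak derivatives tested against \<open>C\<^sup>1\<close> functions
  with compact support in \<open>(0,T)\<close> (as in Brezis' textbook).
\<close>

definition test_function :: "real \<Rightarrow> (real \<Rightarrow> real) \<Rightarrow> bool" where
  "test_function T \<phi> \<longleftrightarrow>
     \<phi> C1_differentiable_on UNIV \<and>
     (\<exists>K. compact K \<and> K \<subseteq> {0<..<T} \<and> (\<forall>t. t \<notin> K \<longrightarrow> \<phi> t = 0))"

definition has_weak_derivative ::
  "real \<Rightarrow> (real \<Rightarrow> real^'m) \<Rightarrow> (real \<Rightarrow> real^'m) \<Rightarrow> bool" where
  "has_weak_derivative T f g \<longleftrightarrow>
     integrable (lebesgue_on {0<..<T}) f \<and>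
     integrable (lebesgue_on {0<..<T}) g \<and>
     (\<forall>\<phi>. test_function T \<phi> \<longrightarrow>
        (LINT t|lebesgue_on {0<..<T}. deriv \<phi> t *\<^sub>R f t) =
        - (LINT t|lebesgue_on {0<..<T}. \<phi> t *\<^sub>R g t))"

definition in_W11 :: "real \<Rightarrow> (real \<Rightarrow> real^'m) \<Rightarrow> bool" where
  "in_W11 T f \<longleftrightarrow> (\<exists>g. has_weak_derivative T f g)"

text \<open>
  A weak derivative is unique only up to null sets, so values of \<open>weak_derivative\<close> are meaningful
  almost everywhere.
\<close>

definition weak_derivative :: "real \<Rightarrow> (real \<Rightarrow> real^'m) \<Rightarrow> real \<Rightarrow> real^'m" where
  "weak_derivative T f = (SOME g. has_weak_derivative T f g)"

text \<open>
  For continuous \<open>v\<close> and \<open>0 < \<alpha> < 1\<close>, the function differentiated below is in \<open>W\<^sup>1\<^sup>,\<^sup>1\<close> as soon as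
  \<open>J\<^sub>t\<^sup>1\<^sup>-\<^sup>\<alpha> v\<close> is, because the two differ by \<open>t\<^sup>1\<^sup>-\<^sup>\<alpha> v(0) / \<Gamma>(2 - \<alpha>)\<close>.
\<close>

definition caputo_defined :: "real \<Rightarrow> real \<Rightarrow> (real \<Rightarrow> real^'m) \<Rightarrow> bool" where
  "caputo_defined \<alpha> T v \<longleftrightarrow>
     continuous_on {0..T} v \<and> in_W11 T (rl_integral (1 - \<alpha>) v)"

definition caputo :: "real \<Rightarrow> real \<Rightarrow> (real \<Rightarrow> real^'m) \<Rightarrow> real \<Rightarrow> real^'m" where
  "caputo \<alpha> T v = weak_derivative T (rl_integral (1 - \<alpha>) (\<lambda>s. v s - v 0))"

definition global_solution ::
  "real \<Rightarrow> real \<Rightarrow> (real \<Rightarrow> real^'m \<Rightarrow> real^'m) \<Rightarrow> real^'m \<Rightarrow> (real \<Rightarrow> real^'m) \<Rightarrow> bool" where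
  "global_solution \<alpha> T G u0 \<phi> \<longleftrightarrow>
     continuous_on {0..T} \<phi> \<and>
     caputo_defined \<alpha> T \<phi> \<and>
     (AE t in lebesgue_on {0..T}. caputo \<alpha> T \<phi> t = G t (\<phi> t)) \<and>
     \<phi> 0 = u0"

end

(*
  Since J^(1-a) J^a is plain integration (Fubini and the Beta integral) and a continuous function
  is the integral of its weak derivative, the Caputo problem is equivalent to the Volterra equation
  u = u0 + J^a G(., u). As a > 1/p, Young's inequality bounds J^a of L^p functions uniformly, and
  such functions are continuous. In the weighted norm sup exp(-l t) |u(t)| the operator J^a has
  small norm for large l. Together with the linear growth of G this gives an a priori bound R for
  all solutions. By compactness, G is Lipschitz on the ball of radius R with one constant for
  almost every t, so composing G with the projection onto that ball yields a contraction in the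
  weighted norm. Its fixed point obeys the bound R, hence solves the original equation, and any
  two solutions, both bounded by R, agree.
*)
theory Submission
  imports Defs
begin

section \<open>The fractional kernel\<close>

text \<open>The condition \<alpha> > 1/p says exactly that the q-th power of the kernel
  x^(\<alpha>-1), with q conjugate to p, is integrable at 0. Young's inequality with a free weight
  is used pointwise in place of Hoelder's, so that no theory of L^p spaces is needed. Two obstacles
  shape the argument. First, \<open>caputo\<close> is defined by an arbitrary choice of weak
  derivative, so the equivalence with the Volterra equation needs weak derivatives of continuous
  functions to be unique almost everywhere. Secondly, in the local Lipschitz hypothesis the
  exceptional null set may depend on the pair x, y, and the neighbourhood on x0. Continuity of
  \<open>G t\<close> and a countable dense set give one null set per ball, and a finite cover gives
  one for a large ball. The a priori bound must precede the Lipschitz constant, since it fixes the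
  radius of that ball. It is therefore stated for every right-hand side of linear growth, which
  includes the equation with the projection. The exponential weight makes the contraction work on
  all of [0,T] at once; with a memory term, continuing solutions from short intervals would be
  awkward.\<close>

text \<open>
  The cutoff at \<open>d\<close> makes the kernel integrable on the whole line. With \<open>d = T\<close> it is invisible
  in \<open>J\<^sub>t\<close> for \<open>t \<le> T\<close>; small \<open>d\<close> isolates the singularity.
\<close>

definition kern :: "real \<Rightarrow> real \<Rightarrow> real \<Rightarrow> real" where
  "kern b d x = (if 0 < x \<and> x \<le> d then x powr (b - 1) else 0)"

lemma kern_nonneg [simp]: "0 \<le> kern b d x"
  by (simp add: kern_def)

lemma kern_measurable [measurable]: "kern b d \<in> borel_measurable borel"
  unfolding kern_def by measurable

lemma kern_integral:
  assumes "0 < b" "0 \<le> d"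
  shows "integrable lebesgue (kern b d)" "(LINT x|lebesgue. kern b d x) = d powr b / b"
proof -
  have "((\<lambda>x. x powr (b - 1)) has_integral (d powr (b - 1 + 1) / (b - 1 + 1))) {0..d}"
    using assms by (intro has_integral_powr_from_0) auto
  then have h: "((\<lambda>x. x powr (b - 1)) has_integral (d powr b / b)) {0..d}"
    by simp
  have "(\<lambda>x. x powr (b - 1)) absolutely_integrable_on {0..d}"
    using h by (intro nonnegative_absolutely_integrable_1) (auto simp: integrable_on_def)
  then have i: "integrable (lebesgue_on {0..d}) (\<lambda>x. x powr (b - 1))"
    by (rule absolutely_integrable_imp_integrable) auto
  have eq: "kern b d = (\<lambda>x. if x \<in> {0..d} then x powr (b - 1) else 0)"
    by (auto simp: kern_def fun_eq_iff)
  show "integrable lebesgue (kern b d)"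
    unfolding eq using i by (intro Lebesgue_Measure.integrable_restrict_UNIV[THEN iffD2]) auto
  show "(LINT x|lebesgue. kern b d x) = d powr b / b"
    unfolding eq using i h
    by (subst Lebesgue_Measure.integral_restrict_UNIV) (auto simp: lebesgue_integral_eq_integral integral_unique)
qed

lemma borel_measurable_lebesgue_onI:
  "f \<in> borel_measurable borel \<Longrightarrow> f \<in> borel_measurable (lebesgue_on S)"
  by (simp add: measurable_completion measurable_restrict_space1)

lemma lebesgue_integrable_reflect:
  fixes f :: "real \<Rightarrow> 'b::euclidean_space"
  assumes "integrable lebesgue f"
  shows "integrable lebesgue (\<lambda>s. f (t - s))" "(LINT s|lebesgue. f (t - s)) = (LINT s|lebesgue. f s)"
  using lebesgue_integrable_real_affine[OF assms, of "-1" t] lebesgue_integral_real_affine[of "-1" f t]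
  by auto

lemma reflect_integral_le:
  fixes g :: "real \<Rightarrow> real"
  assumes "integrable lebesgue g" "\<And>x. 0 \<le> g x" "S \<in> sets lebesgue"
  shows "integrable (lebesgue_on S) (\<lambda>s. g (t - s))"
    "(LINT s|lebesgue_on S. g (t - s)) \<le> (LINT x|lebesgue. g x)"
proof -
  note r = lebesgue_integrable_reflect[OF assms(1), of t]
  show "integrable (lebesgue_on S) (\<lambda>s. g (t - s))"
    using integrable_mult_indicator[OF assms(3) r(1)] assms(3)
    by (intro integrable_restrict_space[THEN iffD2]) auto
  have "(LINT s|lebesgue_on S. g (t - s)) \<le> (LINT s|lebesgue_on UNIV. g (t - s))"
    using r(1) assms by (intro integral_mono_lebesgue_on_AE) (auto simp: lebesgue_on_UNIV_eq)
  then show "(LINT s|lebesgue_on S. g (t - s)) \<le> (LINT x|lebesgue. g x)"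
    using r(2) by (simp add: lebesgue_on_UNIV_eq)
qed

text \<open>Replaces the moving domain {0..t} by the fixed {0..T}, so that linearity, Fubini and
  dominated convergence can be used on one finite measure space. At s = t both integrands
  vanish.\<close>

lemma rl_integral_kern:
  fixes v :: "real \<Rightarrow> real^'m"
  assumes "t \<in> {0..T}"
  shows "rl_integral b v t = (1 / Gamma b) *\<^sub>R (LINT s|lebesgue_on {0..T}. kern b T (t - s) *\<^sub>R v s)"
proof -
  have "(LINT s|lebesgue_on {0..T}. kern b T (t - s) *\<^sub>R v s)
    = (LINT s|lebesgue_on {0..T}. (if s \<in> {0..t} then (t - s) powr (b - 1) *\<^sub>R v s else 0))"
    using assms by (intro Bochner_Integration.integral_cong) (auto simp: kern_def)
  also have "\<dots> = (LINT s|lebesgue_on {0..t}. (t - s) powr (b - 1) *\<^sub>R v s)"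
    using assms by (intro integral_restrict) auto
  finally show ?thesis by (simp add: rl_integral_def)
qed

lemma kern_powr: "kern b d x powr q = kern ((b - 1) * q + 1) d x"
  by (simp add: kern_def powr_powr)

text \<open>Young's inequality for the factors e * |y| and kern / e. Small e makes the part with y
  small at the cost of the kernel part, which is again a kernel, of exponent (b - 1) * q +
  1.\<close>

lemma kern_Young:
  fixes x y :: real
  assumes "1 < p" "0 < e" "q = p / (p - 1)"
  shows "kern b d x * \<bar>y\<bar> \<le> e powr p / p * \<bar>y\<bar> powr p + e powr (-q) / q * kern ((b - 1) * q + 1) d x"
proof -
  have q: "1 < q" "1/p + 1/q = 1"
    unfolding assms(3) using assms(1) by (simp_all add: divide_simps)
  have "kern b d x * \<bar>y\<bar> = (e * \<bar>y\<bar>) * (kern b d x / e)"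
    using assms by simp
  also have "\<dots> \<le> (e * \<bar>y\<bar>) powr p / p + (kern b d x / e) powr q / q"
    using assms q by (intro Youngs_inequality) auto
  also have "(e * \<bar>y\<bar>) powr p = e powr p * \<bar>y\<bar> powr p"
    using assms by (simp add: powr_mult)
  also have "(kern b d x / e) powr q = e powr (-q) * kern ((b - 1) * q + 1) d x"
    using assms by (simp add: powr_divide kern_powr powr_minus field_simps)
  finally show ?thesis by simp
qed

text \<open>This is where 1/p < b enters: the q-th power of the kernel is integrable at 0.\<close>

lemma conj_exponent:
  fixes p q b :: real
  assumes "1 < p" "1 / p < b" "q = p / (p - 1)"
  shows "0 < (b - 1) * q + 1"
proof -
  have "1 < b * p" using pos_divide_less_eq[of p 1 b] assms(1,2) by linarith
  moreover have "(b - 1) * q + 1 = (b * p - 1) / (p - 1)"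
    using assms(1) by (simp add: assms(3) field_simps)
  ultimately show ?thesis using assms(1) by simp
qed

text \<open>Integrating \<open>kern_Young\<close> over s. The bound does not depend on t because the
  reflected kernel is integrated over a subset of the line.\<close>

lemma conv_integrable:
  fixes f :: "real \<Rightarrow> 'b::euclidean_space"
  assumes p: "1 < p" "1 / p < b" and "0 \<le> d"
    and f: "f \<in> borel_measurable (lebesgue_on {0..T})"
    and fp: "integrable (lebesgue_on {0..T}) (\<lambda>s. norm (f s) powr p)"
  shows "integrable (lebesgue_on {0..T}) (\<lambda>s. kern b d (t - s) *\<^sub>R f s)"
    and "0 < e \<Longrightarrow> q = p / (p - 1) \<Longrightarrow>
      (LINT s|lebesgue_on {0..T}. kern b d (t - s) * norm (f s))
       \<le> e powr p / p * (LINT s|lebesgue_on {0..T}. norm (f s) powr p)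
         + e powr (-q) / q * (d powr ((b - 1) * q + 1) / ((b - 1) * q + 1))"
proof -
  define r where "r = p / (p - 1)"
  define c where "c = (b - 1) * r + 1"
  have c: "0 < c" unfolding c_def r_def using conj_exponent[OF p] by simp
  note K = kern_integral[OF c \<open>0 \<le> d\<close>]
  note R = reflect_integral_le[OF K(1) kern_nonneg, of "{0..T}" t]
  have [measurable]: "f \<in> borel_measurable (lebesgue_on {0..T})" by fact
  have km: "(\<lambda>s. kern b d (t - s)) \<in> borel_measurable (lebesgue_on {0..T})"
    by (rule borel_measurable_lebesgue_onI) measurable
  have r: "0 < r" using p by (simp add: r_def)
  have bnd: "integrable (lebesgue_on {0..T}) (\<lambda>s. e powr p / p * norm (f s) powr p + e powr (-r) / r * kern c d (t - s))" for e
    using fp R(1) by auto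
  show *: "integrable (lebesgue_on {0..T}) (\<lambda>s. kern b d (t - s) *\<^sub>R f s)"
  proof (rule Bochner_Integration.integrable_bound[OF bnd[of 1]])
    show "(\<lambda>s. kern b d (t - s) *\<^sub>R f s) \<in> borel_measurable (lebesgue_on {0..T})"
      using km by measurable
    show "AE s in lebesgue_on {0..T}. norm (kern b d (t - s) *\<^sub>R f s)
       \<le> norm (1 powr p / p * norm (f s) powr p + 1 powr (-r) / r * kern c d (t - s))"
      using kern_Young[OF p(1), of 1 r b d _ "norm (f _)"] r p
      by (intro AE_I2) (fastforce simp: c_def r_def intro: order_trans[OF _ abs_ge_self])
  qed
  assume e: "0 < e" and q: "q = p / (p - 1)"
  have qr: "q = r" using q by (simp add: r_def)
  have "(LINT s|lebesgue_on {0..T}. kern b d (t - s) * norm (f s))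
    \<le> (LINT s|lebesgue_on {0..T}. e powr p / p * norm (f s) powr p + e powr (-r) / r * kern c d (t - s))"
  proof (rule integral_mono)
    show "integrable (lebesgue_on {0..T}) (\<lambda>s. kern b d (t - s) * norm (f s))"
      using integrable_norm[OF *] by simp
    show "kern b d (t - s) * norm (f s) \<le> e powr p / p * norm (f s) powr p + e powr (-r) / r * kern c d (t - s)" for s
      using kern_Young[OF p(1) e r_def, of b d "t - s" "norm (f s)"] by (simp add: c_def)
  qed (rule bnd)
  also have "\<dots> = e powr p / p * (LINT s|lebesgue_on {0..T}. norm (f s) powr p)
      + e powr (-r) / r * (LINT s|lebesgue_on {0..T}. kern c d (t - s))"
    using fp R(1) by simp
  also have "\<dots> \<le> e powr p / p * (LINT s|lebesgue_on {0..T}. norm (f s) powr p)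
      + e powr (-r) / r * (d powr c / c)"
    using R(2) K(2) r by (intro add_left_mono mult_left_mono) auto
  finally show "(LINT s|lebesgue_on {0..T}. kern b d (t - s) * norm (f s))
       \<le> e powr p / p * (LINT s|lebesgue_on {0..T}. norm (f s) powr p)
         + e powr (-q) / q * (d powr ((b - 1) * q + 1) / ((b - 1) * q + 1))"
    by (simp add: qr c_def)
qed

lemma truncated_conv_continuous:
  fixes f :: "real \<Rightarrow> 'b::euclidean_space"
  assumes "0 < d" "b \<le> 1" and f: "integrable (lebesgue_on {0..T}) f"
  defines "K \<equiv> \<lambda>x. if 0 < x then (max x d) powr (b - 1) else 0"
  shows "continuous_on A (\<lambda>t. LINT s|lebesgue_on {0..T}. K (t - s) *\<^sub>R f s)"
    "integrable (lebesgue_on {0..T}) (\<lambda>s. K (t - s) *\<^sub>R f s)"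
proof -
  have [measurable]: "f \<in> borel_measurable (lebesgue_on {0..T})" using f by auto
  have Km: "(\<lambda>s. K (t - s)) \<in> borel_measurable (lebesgue_on {0..T})" for t
    by (rule borel_measurable_lebesgue_onI) (simp add: K_def, measurable)
  have m: "(\<lambda>s. K (t - s) *\<^sub>R f s) \<in> borel_measurable (lebesgue_on {0..T})" for t
    using Km[of t] by measurable
  have bd: "norm (K x *\<^sub>R y) \<le> d powr (b - 1) * norm y" for x and y :: 'b
    using assms(1,2) by (auto simp: K_def intro!: mult_right_mono powr_mono2')
  have i: "integrable (lebesgue_on {0..T}) (\<lambda>s. d powr (b - 1) * norm (f s))"
    using f by auto
  show "integrable (lebesgue_on {0..T}) (\<lambda>s. K (t - s) *\<^sub>R f s)"
    by (rule Bochner_Integration.integrable_bound[OF i m]) (use bd in \<open>auto intro: order_trans[OF _ abs_ge_self]\<close>)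
  show "continuous_on A (\<lambda>t. LINT s|lebesgue_on {0..T}. K (t - s) *\<^sub>R f s)"
  proof (rule continuous_on_sequentiallyI)
    fix u a assume u: "u \<longlonglongrightarrow> (a::real)"
    show "(\<lambda>n. LINT s|lebesgue_on {0..T}. K (u n - s) *\<^sub>R f s) \<longlonglongrightarrow> (LINT s|lebesgue_on {0..T}. K (a - s) *\<^sub>R f s)"
    proof (rule integral_dominated_convergence[OF m m i])
      \<comment> \<open>\<open>K\<close> jumps at 0 and is continuous elsewhere, so the integrands
        can fail to converge only at s = a.\<close>
      have "AE s in lebesgue. s \<noteq> a"
        by (rule AE_completion) (rule AE_lborel_singleton)
      then have "AE s in lebesgue_on {0..T}. s \<noteq> a"
        by (simp add: AE_restrict_space_iff) (rule AE_mp, auto)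
      then show "AE s in lebesgue_on {0..T}. (\<lambda>n. K (u n - s) *\<^sub>R f s) \<longlonglongrightarrow> K (a - s) *\<^sub>R f s"
      proof eventually_elim
        case (elim s)
        have lim: "(\<lambda>n. u n - s) \<longlonglongrightarrow> a - s" using u by (intro tendsto_intros)
        have "isCont K (a - s)"
        proof (cases "a - s > 0")
          case True
          have "\<forall>\<^sub>F x in nhds (a - s). K x = (max x d) powr (b - 1)"
            using eventually_nhds_in_open[of "{0<..}" "a - s"] True
            by (auto simp: K_def elim!: eventually_mono)
          moreover have "isCont (\<lambda>x. (max x d) powr (b - 1)) (a - s)"
            using \<open>0 < d\<close> by (intro continuous_intros) auto
          ultimately show ?thesis by (simp add: isCont_cong)
        next
          case False
          then have "\<forall>\<^sub>F x in nhds (a - s). K x = 0"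
            using eventually_nhds_in_open[of "{..<0}" "a - s"] elim
            by (auto simp: K_def elim!: eventually_mono)
          then show ?thesis by (simp add: isCont_cong)
        qed
        then show ?case using lim by (intro tendsto_scaleR tendsto_const isCont_tendsto_compose[of _ K])
      qed
      show "AE s in lebesgue_on {0..T}. norm (K (u n - s) *\<^sub>R f s) \<le> d powr (b - 1) * norm (f s)" for n
        by (intro AE_I2 bd)
    qed
  qed
qed

lemma powr_integrable_imp_integrable:
  fixes f :: "real \<Rightarrow> 'b::euclidean_space"
  assumes "1 \<le> p" "f \<in> borel_measurable (lebesgue_on {0..T})"
    and "integrable (lebesgue_on {0..T}) (\<lambda>s. norm (f s) powr p)"
  shows "integrable (lebesgue_on {0..T}) f"
proof (rule Bochner_Integration.integrable_bound)
  show "integrable (lebesgue_on {0..T}) (\<lambda>s. 1 + norm (f s) powr p)"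
    using assms by auto
  have "y \<le> 1 + y powr p" if "0 \<le> y" for y :: real
  proof (cases "1 \<le> y")
    case True
    then have "y powr 1 \<le> y powr p" using assms by (intro powr_mono) auto
    then show ?thesis using True by simp
  qed (use powr_ge_zero[of y p] in linarith)
  then have "norm (f s) \<le> norm (1 + norm (f s) powr p)" for s by simp
  then show "AE s in lebesgue_on {0..T}. norm (f s) \<le> norm (1 + norm (f s) powr p)"
    by blast
qed (use assms in auto)

text \<open>
  Capping the singularity of the kernel at distance \<open>d\<close> gives a continuous function of \<open>t\<close>. By
  Young's inequality with weight \<open>e\<close>, the error is uniformly small: choose first \<open>e\<close> small, then \<open>d\<close>.
\<close>

lemma conv_continuous:
  fixes f :: "real \<Rightarrow> 'b::euclidean_space"
  assumes p: "1 < p" "1 / p < b" "b \<le> 1" and "0 \<le> T"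
    and f: "f \<in> borel_measurable (lebesgue_on {0..T})"
    and fp: "integrable (lebesgue_on {0..T}) (\<lambda>s. norm (f s) powr p)"
  shows "continuous_on {0..T} (\<lambda>t. LINT s|lebesgue_on {0..T}. kern b T (t - s) *\<^sub>R f s)"
proof -
  define q where "q = p / (p - 1)"
  define c where "c = (b - 1) * q + 1"
  define A where "A = (LINT s|lebesgue_on {0..T}. norm (f s) powr p)"
  define K where "K = (\<lambda>d x. if 0 < x then (max x d) powr (b - 1) else 0)"
  define d where "d = (\<lambda>n. 1 / real (Suc n))"
  have c: "0 < c" unfolding c_def by (rule conj_exponent[OF p(1,2) q_def])
  have q: "0 < q" using p by (simp add: q_def)
  have fi: "integrable (lebesgue_on {0..T}) f"
    using powr_integrable_imp_integrable[OF _ f fp] p by simp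
  have d: "0 < d n" for n by (simp add: d_def)
  have Kc: "continuous_on {0..T} (\<lambda>t. LINT s|lebesgue_on {0..T}. K (d n) (t - s) *\<^sub>R f s)"
    and Ki: "integrable (lebesgue_on {0..T}) (\<lambda>s. K (d n) (t - s) *\<^sub>R f s)" for n t
    using truncated_conv_continuous[OF d p(3) fi] unfolding K_def by blast+
  have diff: "dist (LINT s|lebesgue_on {0..T}. K (d n) (t - s) *\<^sub>R f s) (LINT s|lebesgue_on {0..T}. kern b T (t - s) *\<^sub>R f s)
     \<le> e powr p / p * A + e powr (-q) / q * (d n powr c / c)" if "0 < e" "t \<in> {0..T}" for n t e
  proof -
    note I = conv_integrable[OF p(1,2) \<open>0 \<le> T\<close> f fp, of t]
    have J: "integrable (lebesgue_on {0..T}) (\<lambda>s. kern b (d n) (t - s) * norm (f s))"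
      using integrable_norm[OF conv_integrable(1)[OF p(1,2) less_imp_le[OF d] f fp, of n t]] by simp
    have "norm (LINT s|lebesgue_on {0..T}. K (d n) (t - s) *\<^sub>R f s - kern b T (t - s) *\<^sub>R f s)
      \<le> (LINT s|lebesgue_on {0..T}. norm (K (d n) (t - s) *\<^sub>R f s - kern b T (t - s) *\<^sub>R f s))"
      by (rule integral_norm_bound)
    also have "\<dots> \<le> (LINT s|lebesgue_on {0..T}. kern b (d n) (t - s) * norm (f s))"
    proof (rule integral_mono)
      \<comment> \<open>For x \<le> T the capped and the true kernel differ only on 0 < x < d n, and
        there by at most x^(b-1).\<close>
      fix s assume "s \<in> space (lebesgue_on {0..T})"
      then have "t - s \<le> T" using that by auto
      moreover have "\<bar>K (d n) x - kern b T x\<bar> \<le> kern b (d n) x" if "x \<le> T" for x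
      proof (cases "0 < x \<and> x < d n")
        case True
        then have "d n powr (b - 1) \<le> x powr (b - 1)"
          using p by (intro powr_mono2') auto
        then show ?thesis using True that by (auto simp: K_def kern_def max_def)
      qed (use that d[of n] in \<open>auto simp: K_def kern_def max_def\<close>)
      ultimately have "\<bar>K (d n) (t - s) - kern b T (t - s)\<bar> * norm (f s) \<le> kern b (d n) (t - s) * norm (f s)"
        by (intro mult_right_mono) auto
      then show "norm (K (d n) (t - s) *\<^sub>R f s - kern b T (t - s) *\<^sub>R f s) \<le> kern b (d n) (t - s) * norm (f s)"
        by (simp flip: scaleR_diff_left)
    qed (use Ki I(1) J in \<open>auto intro!: integrable_norm\<close>)
    also have "\<dots> \<le> e powr p / p * A + e powr (-q) / q * (d n powr c / c)"
      unfolding A_def c_def using that d[of n]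
      by (intro conv_integrable(2)[OF p(1,2) _ f fp]) (auto simp: q_def)
    finally show ?thesis
      using Ki I(1) by (simp add: dist_norm)
  qed
  have A: "0 \<le> A" unfolding A_def by (intro integral_nonneg_AE) auto
  have "uniform_limit {0..T} (\<lambda>n t. LINT s|lebesgue_on {0..T}. K (d n) (t - s) *\<^sub>R f s)
     (\<lambda>t. LINT s|lebesgue_on {0..T}. kern b T (t - s) *\<^sub>R f s) sequentially"
  proof (rule uniform_limitI)
    fix \<epsilon> :: real assume "0 < \<epsilon>"
    \<comment> \<open>Chosen so that e^p / p * A = \<epsilon>/2 * A / (A + 1); the + 1 covers A =
      0.\<close>
    define e where "e = (p * (\<epsilon> / 2) / (A + 1)) powr (1 / p)"
    have e: "0 < e" using \<open>0 < \<epsilon>\<close> p A by (simp add: e_def)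
    have "e powr p = p * (\<epsilon> / 2) / (A + 1)"
      using p A \<open>0 < \<epsilon>\<close> by (simp add: e_def powr_powr)
    then have "e powr p / p * A = \<epsilon> / 2 * (A / (A + 1))"
      using p A by (simp add: field_simps)
    also have "\<dots> \<le> \<epsilon> / 2 * 1"
      using A \<open>0 < \<epsilon>\<close> by (intro mult_left_mono) auto
    finally have e1: "e powr p / p * A \<le> \<epsilon> / 2" by simp
    have "d \<longlonglongrightarrow> 0" unfolding d_def by (rule LIMSEQ_Suc) (rule lim_1_over_n)
    moreover have "\<forall>\<^sub>F n in sequentially. 0 \<le> d n" using d by (auto intro!: always_eventually less_imp_le)

    ultimately have dl: "(\<lambda>n. d n powr c) \<longlonglongrightarrow> 0 powr c"
      using c by (intro tendsto_powr2 tendsto_const)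
    have "(\<lambda>n. e powr (-q) / q * (d n powr c / c)) \<longlonglongrightarrow> e powr (-q) / q * (0 powr c / c)"
      using c by (intro tendsto_mult tendsto_divide tendsto_const dl) auto
    then have "\<forall>\<^sub>F n in sequentially. e powr (-q) / q * (d n powr c / c) < \<epsilon> / 2"
      using \<open>0 < \<epsilon>\<close> by (intro order_tendstoD(2)) auto
    then show "\<forall>\<^sub>F n in sequentially. \<forall>t\<in>{0..T}. dist (LINT s|lebesgue_on {0..T}. K (d n) (t - s) *\<^sub>R f s)
       (LINT s|lebesgue_on {0..T}. kern b T (t - s) *\<^sub>R f s) < \<epsilon>"
    proof eventually_elim
      case (elim n)
      show ?case
      proof
        fix t assume "t \<in> {0..T}"
        from diff[OF e this, of n] e1 elim
        show "dist (LINT s|lebesgue_on {0..T}. K (d n) (t - s) *\<^sub>R f s)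
          (LINT s|lebesgue_on {0..T}. kern b T (t - s) *\<^sub>R f s) < \<epsilon>"
          by linarith
      qed
    qed
  qed
  then show ?thesis
    by (rule uniform_limit_theorem[rotated]) (auto intro!: always_eventually Kc)
qed

section \<open>Semigroup property and weak derivatives\<close>

text \<open>The substitution \<tau> = s + (t - s) x produces \<open>Beta b a\<close>. Since a + b =
  1, the powers of t - s cancel against the Jacobian and Gamma (a + b) = 1, so the value is
  independent of t - s.\<close>

lemma beta_kern:
  assumes ab: "0 < a" "0 < b" "a + b = 1" and st: "s \<in> {0..T}" "t \<in> {0..T}"
  shows "has_bochner_integral (lebesgue_on {0..T}) (\<lambda>\<tau>. kern a T (t - \<tau>) * kern b T (\<tau> - s))
     (if s < t then Gamma a * Gamma b else 0)"
proof (cases "s < t")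
  case True
  define h where "h = (\<lambda>x. x powr (b - 1) * (1 - x) powr (a - 1))"
  have hi: "(h has_integral Beta b a) {0..1}"
    unfolding h_def using ab by (intro has_integral_Beta_real)
  have "h absolutely_integrable_on {0..1}"
    using hi by (intro nonnegative_absolutely_integrable_1) (auto simp: integrable_on_def h_def)
  then have i: "integrable (lebesgue_on {0..1}) h"
    by (rule absolutely_integrable_imp_integrable) auto
  have "has_bochner_integral lebesgue (\<lambda>x. indicator {0..1} x *\<^sub>R h x) (Beta b a)"
    using i hi by (subst has_bochner_integral_restrict_space[symmetric])
      (auto simp: has_bochner_integral_iff lebesgue_integral_eq_integral integral_unique)
  then have "has_bochner_integral lebesgue (\<lambda>x. indicator {0..1} (- s / (t - s) + 1 / (t - s) * x)
     *\<^sub>R h (- s / (t - s) + 1 / (t - s) * x)) (Beta b a /\<^sub>R \<bar>1 / (t - s)\<bar>)"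
    using True by (subst has_bochner_integral_lebesgue_real_affine_iff[symmetric]) auto
  also have "Beta b a /\<^sub>R \<bar>1 / (t - s)\<bar> = (t - s) * (Gamma a * Gamma b)"
    using True ab by (simp add: Beta_def add.commute)
  also have "(\<lambda>x. indicator {0..1} (- s / (t - s) + 1 / (t - s) * x)
     *\<^sub>R h (- s / (t - s) + 1 / (t - s) * x))
    = (\<lambda>x. (t - s) * (indicator {0..T} x *\<^sub>R (kern a T (t - x) * kern b T (x - s))))"
  proof
    fix x
    have e: "- s / (t - s) + 1 / (t - s) * x = (x - s) / (t - s)"
      by (simp add: diff_divide_distrib)
    have e': "1 - (x - s) / (t - s) = (t - x) / (t - s)"
      using True by (simp add: field_simps)
    have "b - 1 + (a - 1) = -1" using ab by simp
    then have "(t - s) powr (b - 1) * (t - s) powr (a - 1) = (t - s) powr (-1)"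
      by (metis powr_add)
    then have c: "(t - s) powr (b - 1) * (t - s) powr (a - 1) = 1 / (t - s)"
      using True by (simp add: powr_minus_divide)
    have "(t - s) * (kern a T (t - x) * kern b T (x - s)) = h ((x - s) / (t - s))" if "s < x" "x < t"
    proof -
      have "h ((x - s) / (t - s)) = (x - s) powr (b - 1) * (t - x) powr (a - 1) / ((t - s) powr (b - 1) * (t - s) powr (a - 1))"
        unfolding h_def e' using that by (simp add: powr_divide)
      then show ?thesis unfolding c using that st by (simp add: kern_def)
    qed
    \<comment> \<open>At the endpoints the indicator of [0,1] is 1 while the kernels vanish; the
      convention \<open>0 powr a = 0\<close> makes both sides agree.\<close>
    moreover have "h ((x - s) / (t - s)) = 0" if "x = s \<or> x = t"
      using that True by (auto simp: h_def)
    moreover have "(x - s) / (t - s) \<in> {0..1} \<longleftrightarrow> s \<le> x \<and> x \<le> t"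
      using True by (auto simp: field_simps)
    ultimately show "indicator {0..1} (- s / (t - s) + 1 / (t - s) * x)
      *\<^sub>R h (- s / (t - s) + 1 / (t - s) * x) = (t - s) * (indicator {0..T} x *\<^sub>R (kern a T (t - x) * kern b T (x - s)))"
      unfolding e using st by (auto simp: indicator_def kern_def not_le not_less)
  qed
  finally have "has_bochner_integral lebesgue (\<lambda>x. (1 / (t - s)) * ((t - s) * (indicator {0..T} x *\<^sub>R (kern a T (t - x) * kern b T (x - s)))))
     ((1 / (t - s)) * ((t - s) * (Gamma a * Gamma b)))"
    by (rule has_bochner_integral_mult_right)
  then show ?thesis using True by (simp add: has_bochner_integral_restrict_space)
next
  case False
  then have "(\<lambda>\<tau>. kern a T (t - \<tau>) * kern b T (\<tau> - s)) = (\<lambda>\<tau>. 0)"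
    by (auto simp: kern_def)
  then show ?thesis using False by (simp add: has_bochner_integral_iff)
qed

lemma finite_measure_lebesgue_on_Icc: "finite_measure (lebesgue_on {0..T::real})"
  by (intro finite_measure_lebesgue_on lmeasurable_interval)

lemma pair_sigma_finite_lebesgue_on_Icc:
  "pair_sigma_finite (lebesgue_on {0..T::real}) (lebesgue_on {0..T})"
proof -
  interpret finite_measure "lebesgue_on {0..T}" by (rule finite_measure_lebesgue_on_Icc)
  show ?thesis by unfold_locales
qed

lemma integral_upto:
  fixes f :: "real \<Rightarrow> 'b::euclidean_space"
  assumes "t \<in> {0..T}"
  shows "(LINT s|lebesgue_on {0..T}. (if s \<le> t then f s else 0)) = (LINT s|lebesgue_on {0..t}. f s)"
proof -
  have "(LINT s|lebesgue_on {0..T}. (if s \<le> t then f s else 0)) = (LINT s|lebesgue_on {0..T}. (if s \<in> {0..t} then f s else 0))"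
    by (intro Bochner_Integration.integral_cong) auto
  then show ?thesis using assms by (subst (asm) integral_restrict) auto
qed

lemma AE_lebesgue_on_neq: "AE s in lebesgue_on S. s \<noteq> (a::real)" if "S \<in> sets lebesgue"
proof -
  have "AE s in lebesgue. s \<noteq> a"
    by (rule AE_completion) (rule AE_lborel_singleton)
  then show ?thesis using that
    by (simp add: AE_restrict_space_iff) (rule AE_mp, auto)
qed

lemma borel_measurable_fst_snd_lebesgue_on:
  "fst \<in> borel_measurable (lebesgue_on A \<Otimes>\<^sub>M lebesgue_on B)"
  "snd \<in> borel_measurable (lebesgue_on A \<Otimes>\<^sub>M lebesgue_on B)"
  using measurable_compose[OF measurable_fst borel_measurable_lebesgue_onI[of "\<lambda>x. x"]]
    measurable_compose[OF measurable_snd borel_measurable_lebesgue_onI[of "\<lambda>x. x"]] by auto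

text \<open>Fubini: for fixed s the integral over \<tau> is the Beta integral. As the kernels are
  nonnegative, the same computation with norms gives the majorant Gamma a * Gamma b * norm (f s),
  which justifies the exchange.\<close>

lemma kern_semigroup:
  fixes f :: "real \<Rightarrow> 'b::euclidean_space"
  assumes ab: "0 < a" "0 < b" "a + b = 1" and t: "t \<in> {0..T}"
    and f: "integrable (lebesgue_on {0..T}) f"
  shows "(LINT \<tau>|lebesgue_on {0..T}. kern a T (t - \<tau>) *\<^sub>R (LINT s|lebesgue_on {0..T}. kern b T (\<tau> - s) *\<^sub>R f s))
    = (Gamma a * Gamma b) *\<^sub>R (LINT s|lebesgue_on {0..t}. f s)"
proof -
  let ?M = "lebesgue_on {0..T}"
  interpret pair_sigma_finite ?M ?M by (rule pair_sigma_finite_lebesgue_on_Icc)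
  define k where "k = (\<lambda>s \<tau>. kern a T (t - \<tau>) * kern b T (\<tau> - s))"
  define F where "F = (\<lambda>s \<tau>. k s \<tau> *\<^sub>R f s)"
  have [measurable]: "f \<in> borel_measurable ?M" using f by auto
  note [measurable] = borel_measurable_fst_snd_lebesgue_on
  have meas: "case_prod F \<in> borel_measurable (?M \<Otimes>\<^sub>M ?M)"
    unfolding F_def k_def by measurable
  have hb: "has_bochner_integral ?M (k s) (if s < t then Gamma a * Gamma b else 0)" if "s \<in> {0..T}" for s
    unfolding k_def by (rule beta_kern[OF ab that t])
  have kn: "0 \<le> k s \<tau>" for s \<tau> by (simp add: k_def)
  have Fi: "(LINT \<tau>|?M. F s \<tau>) = (if s < t then (Gamma a * Gamma b) *\<^sub>R f s else 0)"
    and Fn: "(LINT \<tau>|?M. norm (F s \<tau>)) = (if s < t then (Gamma a * Gamma b) * norm (f s) else 0)"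
    and Fint: "integrable ?M (F s)" if "s \<in> {0..T}" for s
    using hb[OF that] kn by (auto simp: F_def has_bochner_integral_iff)
  have "integrable ?M (\<lambda>s. if s < t then (Gamma a * Gamma b) * norm (f s) else 0)"
  proof (rule Bochner_Integration.integrable_bound)
    show "integrable ?M (\<lambda>s. (Gamma a * Gamma b) * norm (f s))" using f by auto
    have "(\<lambda>s. s) \<in> borel_measurable ?M" by (rule borel_measurable_lebesgue_onI) simp
    then show "(\<lambda>s. if s < t then (Gamma a * Gamma b) * norm (f s) else 0) \<in> borel_measurable ?M"
      by measurable
  qed auto
  then have "integrable ?M (\<lambda>s. LINT \<tau>|?M. norm (F s \<tau>))"
    by (rule Bochner_Integration.integrable_cong[THEN iffD2, rotated -1]) (simp_all add: Fn)
  then have "integrable (?M \<Otimes>\<^sub>M ?M) (case_prod F)"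
    using Fint by (intro Fubini_integrable meas) auto
  from Fubini_integral[OF this]
  have "(LINT \<tau>|?M. LINT s|?M. F s \<tau>) = (LINT s|?M. LINT \<tau>|?M. F s \<tau>)" .
  also have "\<dots> = (LINT s|?M. (if s < t then (Gamma a * Gamma b) *\<^sub>R f s else 0))"
    by (intro Bochner_Integration.integral_cong refl Fi) simp
  finally have "(LINT \<tau>|?M. LINT s|?M. F s \<tau>) = (LINT s|?M. (if s < t then (Gamma a * Gamma b) *\<^sub>R f s else 0))" .
  moreover have "(LINT s|?M. F s \<tau>) = kern a T (t - \<tau>) *\<^sub>R (LINT s|?M. kern b T (\<tau> - s) *\<^sub>R f s)" for \<tau>
    unfolding F_def k_def by (simp flip: scaleR_scaleR)
  \<comment> \<open>\<open>s < t\<close> comes from the Beta integral, \<open>s \<le> t\<close> from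
    the integral over {0..t}; they differ at one point only.\<close>
  moreover have "(LINT s|?M. (if s < t then (Gamma a * Gamma b) *\<^sub>R f s else 0))
    = (LINT s|?M. (Gamma a * Gamma b) *\<^sub>R (if s \<le> t then f s else 0))"
  proof (rule integral_cong_AE)
    have "(\<lambda>s. s) \<in> borel_measurable ?M" by (rule borel_measurable_lebesgue_onI) simp
    note [measurable] = this
    show "(\<lambda>s. if s < t then (Gamma a * Gamma b) *\<^sub>R f s else 0) \<in> borel_measurable ?M"
      "(\<lambda>s. (Gamma a * Gamma b) *\<^sub>R (if s \<le> t then f s else 0)) \<in> borel_measurable ?M"
      by measurable
    show "AE s in ?M. (if s < t then (Gamma a * Gamma b) *\<^sub>R f s else 0) = (Gamma a * Gamma b) *\<^sub>R (if s \<le> t then f s else 0)"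
      using AE_lebesgue_on_neq[of "{0..T}" t, simplified] by eventually_elim auto
  qed
  ultimately show ?thesis using integral_upto[OF t, where f = f] by simp
qed

section \<open>Integration by parts for weak derivatives\<close>

lemma lebesgue_on_Ioo_Icc:
  fixes f :: "real \<Rightarrow> 'b::euclidean_space"
  shows "integrable (lebesgue_on {a<..<b}) f \<longleftrightarrow> integrable (lebesgue_on {a..b}) f"
    and "(LINT t|lebesgue_on {a<..<b}. f t) = (LINT t|lebesgue_on {a..b}. f t)"
proof -
  have e: "integrable (lebesgue_on S) f \<longleftrightarrow> f absolutely_integrable_on S" if "S \<in> sets lebesgue" for S
    using that by (simp add: set_integrable_def integrable_restrict_space)
  show i: "integrable (lebesgue_on {a<..<b}) f \<longleftrightarrow> integrable (lebesgue_on {a..b}) f"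
    using absolutely_integrable_on_open_interval[of a b f] by (simp add: e)
  show "(LINT t|lebesgue_on {a<..<b}. f t) = (LINT t|lebesgue_on {a..b}. f t)"
  proof (cases "integrable (lebesgue_on {a..b}) f")
    case True
    then show ?thesis using i by (simp add: lebesgue_integral_eq_integral integral_open_interval_real)
  next
    case False
    then show ?thesis using i by (simp add: not_integrable_integral_eq)
  qed
qed

text \<open>Moves the definition from the open interval to the closed one, over which the kernel
  integrals are taken.\<close>

lemma has_weak_derivative_iff:
  "has_weak_derivative T f g \<longleftrightarrow>
     integrable (lebesgue_on {0..T}) f \<and> integrable (lebesgue_on {0..T}) g \<and>
     (\<forall>\<phi>. test_function T \<phi> \<longrightarrow>
        (LINT t|lebesgue_on {0..T}. deriv \<phi> t *\<^sub>R f t) = - (LINT t|lebesgue_on {0..T}. \<phi> t *\<^sub>R g t))"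
  unfolding has_weak_derivative_def lebesgue_on_Ioo_Icc ..

lemma test_functionD:
  assumes "test_function T \<phi>" "0 < T"
  shows "\<And>t. (\<phi> has_vector_derivative deriv \<phi> t) (at t)" "continuous_on UNIV (deriv \<phi>)" "\<phi> 0 = 0" "\<phi> T = 0"
proof -
  obtain D where D: "\<And>x. (\<phi> has_vector_derivative D x) (at x)" "continuous_on UNIV D"
    using assms unfolding test_function_def C1_differentiable_on_def by auto
  have "deriv \<phi> = D"
    using D(1) by (intro ext DERIV_imp_deriv) (simp add: has_real_derivative_iff_has_vector_derivative)
  with D show "\<And>t. (\<phi> has_vector_derivative deriv \<phi> t) (at t)" "continuous_on UNIV (deriv \<phi>)" by auto
  show "\<phi> 0 = 0" "\<phi> T = 0"
    using assms unfolding test_function_def by (fastforce simp: subset_eq)+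
qed

text \<open>\<open>f\<close> is merely integrable, so Fubini on the triangle s \<le> t takes the
  place of the product rule: the integral of \<phi>' over [s,T] is - \<phi> s, because \<phi> T =
  0.\<close>

lemma has_weak_derivative_integral:
  fixes f :: "real \<Rightarrow> real^'m"
  assumes T: "0 < T" and f: "integrable (lebesgue_on {0..T}) f"
    and F: "\<And>t. t \<in> {0..T} \<Longrightarrow> F t = (LINT s|lebesgue_on {0..t}. f s)"
  shows "has_weak_derivative T F f"
  unfolding has_weak_derivative_iff
proof (intro conjI allI impI)
  let ?M = "lebesgue_on {0..T}"
  interpret pair_sigma_finite ?M ?M by (rule pair_sigma_finite_lebesgue_on_Icc)
  interpret finite_measure ?M by (rule finite_measure_lebesgue_on_Icc)
  show "integrable ?M f" by fact
  have "continuous_on {0..T} F"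
    using indefinite_integral_continuous_real[OF f] by (rule continuous_on_eq) (simp add: F)
  then show "integrable ?M F"
    by (intro continuous_imp_integrable_real)
  fix \<phi> assume "test_function T \<phi>"
  note \<phi> = test_functionD[OF this T]
  define D where "D = deriv \<phi>"
  have Dc: "continuous_on {0..T} D" using \<phi>(2) unfolding D_def by (rule continuous_on_subset) auto
  then have "bounded (D ` {0..T})"
    by (intro compact_imp_bounded compact_continuous_image) auto
  then obtain B where B: "\<And>t. t \<in> {0..T} \<Longrightarrow> \<bar>D t\<bar> \<le> B"
    unfolding bounded_iff by (metis imageI real_norm_def)
  have B0: "0 \<le> B" using B[of 0] T by auto
  define H where "H = (\<lambda>s t. (if s \<le> t then D t else 0) *\<^sub>R f s)"
  have [measurable]: "f \<in> borel_measurable ?M" using f by auto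
  have [measurable]: "D \<in> borel_measurable borel"
    using \<phi>(2) unfolding D_def by (rule borel_measurable_continuous_onI)
  note [measurable] = borel_measurable_fst_snd_lebesgue_on
  have meas: "case_prod H \<in> borel_measurable (?M \<Otimes>\<^sub>M ?M)"
    unfolding H_def by measurable
  have "integrable (?M \<Otimes>\<^sub>M ?M) (\<lambda>(s, t). B *\<^sub>R f s)"
  proof (rule Fubini_integrable)
    show "(\<lambda>(s, t). B *\<^sub>R f s) \<in> borel_measurable (?M \<Otimes>\<^sub>M ?M)" by measurable
  qed (use f in auto)
  then have "integrable (?M \<Otimes>\<^sub>M ?M) (case_prod H)"
  proof (rule Bochner_Integration.integrable_bound[OF _ meas])
    show "AE x in ?M \<Otimes>\<^sub>M ?M. norm (case_prod H x) \<le> norm (case x of (s, t) \<Rightarrow> B *\<^sub>R f s)"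
      using B B0 by (intro AE_I2) (auto simp: H_def space_pair_measure intro!: mult_right_mono)
  qed
  from Fubini_integral[OF this]
  have "(LINT t|?M. LINT s|?M. H s t) = (LINT s|?M. LINT t|?M. H s t)" .
  moreover have Ht: "(LINT s|?M. H s t) = deriv \<phi> t *\<^sub>R F t" if "t \<in> {0..T}" for t
  proof -
    have "(LINT s|?M. H s t) = (LINT s|?M. D t *\<^sub>R (if s \<le> t then f s else 0))"
      unfolding H_def by (intro Bochner_Integration.integral_cong) auto
    then show ?thesis using integral_upto[OF that, where f = f] F[OF that] by (simp add: D_def)
  qed
  moreover have Hs: "(LINT t|?M. H s t) = - (\<phi> s *\<^sub>R f s)" if s: "s \<in> {0..T}" for s
  proof -
    have "(LINT t|?M. (if s \<le> t then D t else 0)) = (LINT t|?M. (if t \<in> {s..T} then D t else 0))"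
      by (intro Bochner_Integration.integral_cong) auto
    also have "\<dots> = (LINT t|lebesgue_on {s..T}. D t)"
      using s by (intro integral_restrict) auto
    also have "\<dots> = integral {s..T} D"
      using s Dc by (intro lebesgue_integral_eq_integral continuous_imp_integrable_real) (auto elim: continuous_on_subset)
    also have "\<dots> = \<phi> T - \<phi> s"
      using s \<phi>(1) unfolding D_def
      by (intro integral_unique fundamental_theorem_of_calculus) (auto intro: has_vector_derivative_at_within)
    finally have i: "(LINT t|?M. (if s \<le> t then D t else 0)) = - \<phi> s" using \<phi> by simp
    have "(LINT t|?M. H s t) = (LINT t|?M. (if s \<le> t then D t else 0)) *\<^sub>R f s"
      unfolding H_def
    proof (rule integral_scaleR_left)
      have "(\<lambda>s. s) \<in> borel_measurable ?M" by (rule borel_measurable_lebesgue_onI) simp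
      note [measurable] = this
      show "integrable ?M (\<lambda>t. if s \<le> t then D t else 0)"
      proof (rule Bochner_Integration.integrable_bound[of _ "\<lambda>_. B"])
        show "(\<lambda>t. if s \<le> t then D t else 0) \<in> borel_measurable ?M" by measurable
        show "AE t in ?M. norm (if s \<le> t then D t else 0) \<le> norm B"
          using B B0 by (intro AE_I2) auto
      qed simp
    qed
    then show ?thesis using i by simp
  qed
  moreover have "(LINT t|?M. LINT s|?M. H s t) = (LINT t|?M. deriv \<phi> t *\<^sub>R F t)"
    by (intro Bochner_Integration.integral_cong refl Ht) simp
  moreover have "(LINT s|?M. LINT t|?M. H s t) = (LINT s|?M. - (\<phi> s *\<^sub>R f s))"
    by (intro Bochner_Integration.integral_cong refl Hs) simp
  ultimately show "(LINT t|?M. deriv \<phi> t *\<^sub>R F t) = - (LINT t|?M. \<phi> t *\<^sub>R f t)"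
    by simp
qed

section \<open>Smoothed steps as test functions, and recovery of a function from its weak
  derivative\<close>

lemma DERIV_max0_square:
  "((\<lambda>x::real. (max 0 x)\<^sup>2) has_real_derivative 2 * max 0 x) (at x)"
proof (cases "x = 0")
  case True
  have "((\<lambda>h. ((max 0 (0 + h))\<^sup>2 - (max 0 0)\<^sup>2) / h) \<longlongrightarrow> 0) (at (0::real))"
  proof (rule Lim_null_comparison)
    show "\<forall>\<^sub>F h::real in at 0. norm (((max 0 (0 + h))\<^sup>2 - (max 0 0)\<^sup>2) / h) \<le> \<bar>h\<bar>"
      by (intro always_eventually) (auto simp: max_def power2_eq_square)
    show "((\<lambda>h::real. \<bar>h\<bar>) \<longlongrightarrow> 0) (at 0)"
      by (intro tendsto_rabs_zero tendsto_ident_at)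
  qed
  then show ?thesis using True by (simp add: DERIV_def)
next
  case False
  then consider "x < 0" | "0 < x" by linarith
  then show ?thesis
  proof cases
    case 1
    have "((\<lambda>x::real. 0) has_real_derivative 2 * max 0 x) (at x)"
      using 1 by simp
    then show ?thesis
      by (rule has_field_derivative_transform_within_open[of _ _ _ "{..<0}"]) (use 1 in auto)
  next
    case 2
    have "((\<lambda>x::real. x\<^sup>2) has_real_derivative 2 * max 0 x) (at x)"
      using 2 by (auto intro!: derivative_eq_intros)
    then show ?thesis
      by (rule has_field_derivative_transform_within_open[of _ _ _ "{0<..}"]) (use 2 in auto)
  qed
qed

text \<open>The hat function on [0,2] with peak and integral 1, written as a second difference so
  that an antiderivative is explicit.\<close>

definition tent :: "real \<Rightarrow> real" where
  "tent x = max 0 x - 2 * max 0 (x - 1) + max 0 (x - 2)"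

text \<open>The antiderivative of \<open>tent\<close>: a C1 passage from 0 to 1 on [0,2]. Test
  functions need only be C1, so a piecewise quadratic suffices.\<close>

definition step :: "real \<Rightarrow> real" where
  "step x = ((max 0 x)\<^sup>2 - 2 * (max 0 (x - 1))\<^sup>2 + (max 0 (x - 2))\<^sup>2) / 2"

lemma DERIV_step: "(step has_real_derivative tent x) (at x)"
proof -
  have *: "((\<lambda>x. (max 0 (x - c))\<^sup>2) has_real_derivative 2 * max 0 (x - c)) (at x)" for c
    using DERIV_shift[of "\<lambda>x. (max 0 x)\<^sup>2" "2 * max 0 (x - c)" x "-c"] DERIV_max0_square[of "x - c"] by simp
  show ?thesis
    unfolding step_def[abs_def] tent_def
    using DERIV_cdivide[OF DERIV_add[OF DERIV_diff[OF DERIV_max0_square DERIV_cmult[OF *[of 1], of 2]] *[of 2]], of 2]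
    by (simp add: add_divide_distrib diff_divide_distrib)
qed

lemma continuous_tent: "continuous_on A tent"
  unfolding tent_def[abs_def] by (intro continuous_intros)

lemma tent_measurable [measurable]: "tent \<in> borel_measurable borel"
  unfolding tent_def[abs_def] by measurable

lemma tent_bounds: "0 \<le> tent x" "tent x \<le> 1"
  by (auto simp: tent_def max_def)

lemma tent_eq_0: "x \<le> 0 \<or> 2 \<le> x \<Longrightarrow> tent x = 0"
  by (auto simp: tent_def max_def)

lemma step_eq_0: "x \<le> 0 \<Longrightarrow> step x = 0"
  by (auto simp: step_def max_def)

lemma step_eq_1: "2 \<le> x \<Longrightarrow> step x = 1"
  by (auto simp: step_def max_def power2_eq_square algebra_simps)

lemma step_mono: "x \<le> y \<Longrightarrow> step x \<le> step y"
  using DERIV_step tent_bounds(1) by (intro DERIV_nonneg_imp_nondecreasing[of x y step]) blast+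

lemma step_bounds: "0 \<le> step x" "step x \<le> 1"
  using step_mono[of "min x 0" x] step_mono[of x "max x 2"] step_eq_0[of "min x 0"] step_eq_1[of "max x 2"] by auto

lemma has_bochner_integral_tent: "has_bochner_integral lebesgue tent 1"
proof -
  have "(tent has_integral (step 2 - step 0)) {0..2}"
    using DERIV_step by (intro fundamental_theorem_of_calculus)
      (auto simp: has_real_derivative_iff_has_vector_derivative[symmetric] intro: has_field_derivative_at_within)
  then have i: "(tent has_integral 1) {0..2}" by (simp add: step_eq_0 step_eq_1)
  have "integrable (lebesgue_on {0..2}) tent"
    by (intro continuous_imp_integrable_real continuous_tent)
  with i have "has_bochner_integral (lebesgue_on {0..2}) tent 1"
    by (simp add: has_bochner_integral_iff lebesgue_integral_eq_integral integral_unique)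
  then have "has_bochner_integral lebesgue (\<lambda>x. indicator {0..2} x *\<^sub>R tent x) 1"
    by (subst (asm) has_bochner_integral_restrict_space) auto
  also have "(\<lambda>x. indicator {0..2} x *\<^sub>R tent x) = tent"
    by (rule ext) (auto simp: indicator_def tent_def max_def)
  finally show ?thesis .
qed

text \<open>The scaled tent has mass 1 and lives on [a, a + 2/N], to the right of a. Once 2/N < T -
  a no mass is lost, even for a = 0.\<close>

lemma tent_approximates_delta:
  fixes w :: "real \<Rightarrow> 'b::euclidean_space"
  assumes w: "continuous_on {0..T} w" and a: "0 \<le> a" "a < T"
  shows "(\<lambda>n. LINT t|lebesgue_on {0..T}. (real (Suc n) * tent (real (Suc n) * (t - a))) *\<^sub>R w t) \<longlonglongrightarrow> w a"
proof -
  \<comment> \<open>A bounded continuous extension of \<open>w\<close>: after substituting x = N (t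
    - a) the domain varies with N, and dominated convergence needs one majorant on the whole
    line.\<close>
  obtain g :: "real \<Rightarrow>\<^sub>C 'b" where g: "\<And>x. x \<in> cbox 0 T \<Longrightarrow> g x = w x"
    using continuous_on_cbox_bcontfunE[of 0 T w] w by (metis interval_cbox)
  have gc: "isCont (apply_bcontfun g) x" for x
    by (metis UNIV_I continuous_on_apply_bcontfun continuous_on_eq_continuous_at open_UNIV)
  have gm [measurable]: "apply_bcontfun g \<in> borel_measurable borel"
    by (rule borel_measurable_continuous_onI) simp
  have m: "(\<lambda>x. tent x *\<^sub>R g (f x)) \<in> borel_measurable lebesgue" if "f \<in> borel_measurable borel" for f
    using that by (intro measurable_completion) measurable
  have "(\<lambda>n. LINT x|lebesgue. tent x *\<^sub>R g (a + x / real (Suc n))) \<longlonglongrightarrow> (LINT x|lebesgue. tent x *\<^sub>R g a)"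
  proof (rule integral_dominated_convergence)
    show "integrable lebesgue (\<lambda>x. tent x * norm g)"
      using has_bochner_integral_tent by (auto simp: has_bochner_integral_iff)
    have "(\<lambda>n. tent x *\<^sub>R g (a + x / real (Suc n))) \<longlonglongrightarrow> tent x *\<^sub>R g a" for x
    proof -
      have "(\<lambda>n. a + x * (1 / real (Suc n))) \<longlonglongrightarrow> a + x * 0"
        by (intro tendsto_intros LIMSEQ_Suc[OF lim_1_over_n])
      then have "(\<lambda>n. a + x / real (Suc n)) \<longlonglongrightarrow> a" by simp
      then show ?thesis by (intro tendsto_scaleR tendsto_const isCont_tendsto_compose[OF gc])
    qed
    then show "AE x in lebesgue. (\<lambda>n. tent x *\<^sub>R g (a + x / real (Suc n))) \<longlonglongrightarrow> tent x *\<^sub>R g a"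
      by simp
    show "AE x in lebesgue. norm (tent x *\<^sub>R g (a + x / real (Suc n))) \<le> tent x * norm g" for n
      using tent_bounds norm_bounded[of g] by (intro AE_I2) (auto intro!: mult_mono)
  qed (auto intro!: m)
  also have "(LINT x|lebesgue. tent x *\<^sub>R g a) = w a"
    using has_bochner_integral_tent a g[of a] by (auto simp: has_bochner_integral_iff)
  finally have lim: "(\<lambda>n. LINT x|lebesgue. tent x *\<^sub>R g (a + x / real (Suc n))) \<longlonglongrightarrow> w a" .
  have "\<forall>\<^sub>F n in sequentially. 2 / (T - a) < real (Suc n)"
    using filterlim_compose[OF filterlim_real_sequentially filterlim_Suc] by (simp add: filterlim_at_top_dense)
  then have "\<forall>\<^sub>F n in sequentially. (LINT x|lebesgue. tent x *\<^sub>R g (a + x / real (Suc n)))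
    = (LINT t|lebesgue_on {0..T}. (real (Suc n) * tent (real (Suc n) * (t - a))) *\<^sub>R w t)"
  proof eventually_elim
    case (elim n)
    define N where "N = real (Suc n)"
    have N: "0 < N" "2 < N * (T - a)"
      using elim a by (simp_all add: N_def field_simps)
    have "(LINT x|lebesgue. tent x *\<^sub>R g (a + x / N)) =
       N *\<^sub>R (LINT t|lebesgue. tent (- N * a + N * t) *\<^sub>R g (a + (- N * a + N * t) / N))"
      using N lebesgue_integral_real_affine[of N "\<lambda>x. tent x *\<^sub>R g (a + x / N)" "- N * a"] by simp
    also have "\<dots> = (LINT t|lebesgue. N *\<^sub>R (tent (- N * a + N * t) *\<^sub>R g (a + (- N * a + N * t) / N)))"
      by (rule integral_scaleR_right[symmetric])
    also have "\<dots> = (LINT t|lebesgue. (if t \<in> {0..T} then (N * tent (N * (t - a))) *\<^sub>R w t else 0))"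
    proof (rule Bochner_Integration.integral_cong[OF refl])
      fix t
      have e: "a + (- N * a + N * t) / N = t" "- N * a + N * t = N * (t - a)"
        using N by (simp_all add: field_simps)
      have "tent (N * (t - a)) = 0" if nt: "t \<notin> {0..T}"
      proof (rule tent_eq_0)
        consider "t < 0" | "T < t" using nt by fastforce
        then show "N * (t - a) \<le> 0 \<or> 2 \<le> N * (t - a)"
        proof cases
          case 1
          then show ?thesis using N a by (simp add: mult_le_0_iff)
        next
          case 2
          then have "N * (T - a) \<le> N * (t - a)" using N by (intro mult_left_mono) auto
          then show ?thesis using N by linarith
        qed
      qed
      then show "N *\<^sub>R (tent (- N * a + N * t) *\<^sub>R g (a + (- N * a + N * t) / N))
        = (if t \<in> {0..T} then (N * tent (N * (t - a))) *\<^sub>R w t else 0)"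
        unfolding e using g[of t] by auto
    qed
    also have "\<dots> = (LINT t|lebesgue_on {0..T}. (N * tent (N * (t - a))) *\<^sub>R w t)"
      by (rule Lebesgue_Measure.integral_restrict_UNIV) simp
    finally show ?case by (simp add: N_def)
  qed
  with lim show ?thesis by (rule Lim_transform_eventually)
qed

lemma step_tendsto: "(\<lambda>n. step (real (Suc n) * x)) \<longlonglongrightarrow> (if 0 < x then 1 else 0)"
proof (cases "0 < x")
  case True
  have "\<forall>\<^sub>F n in sequentially. 2 / x < real (Suc n)"
    using filterlim_compose[OF filterlim_real_sequentially filterlim_Suc] by (simp add: filterlim_at_top_dense)
  then have "\<forall>\<^sub>F n in sequentially. step (real (Suc n) * x) = 1"
    by eventually_elim (use True in \<open>auto intro!: step_eq_1 simp: field_simps\<close>)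
  then show ?thesis using True by (simp add: tendsto_eventually)
next
  case False
  then have "step (real (Suc n) * x) = 0" for n
    by (intro step_eq_0) (simp add: mult_le_0_iff)
  then show ?thesis using False by simp
qed

text \<open>Test with a smoothed indicator of (a,b]. Its derivative is a difference of approximate
  delta functions at a and b, and its support [a, b + 2/N] lies inside (0,T) for large N.\<close>

lemma weak_derivative_increment:
  fixes w :: "real \<Rightarrow> real^'m"
  assumes wd: "has_weak_derivative T w g" and w: "continuous_on {0..T} w"
    and ab: "0 < a" "a < b" "b < T"
  shows "(LINT t|lebesgue_on {0..T}. (if a < t \<and> t \<le> b then g t else 0)) = w b - w a"
proof -
  let ?M = "lebesgue_on {0..T}"
  have T: "0 < T" using ab by simp
  have gi: "integrable ?M g"
    and tf: "\<And>\<phi>. test_function T \<phi> \<Longrightarrow> (LINT t|?M. deriv \<phi> t *\<^sub>R w t) = - (LINT t|?M. \<phi> t *\<^sub>R g t)"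
    using wd unfolding has_weak_derivative_iff by auto
  have [measurable]: "g \<in> borel_measurable ?M" using gi by auto
  have "(\<lambda>s. s) \<in> borel_measurable ?M" by (rule borel_measurable_lebesgue_onI) simp
  note [measurable] = this
  define \<phi> where "\<phi> = (\<lambda>n t. step (real (Suc n) * (t - a)) - step (real (Suc n) * (t - b)))"
  define \<psi> where "\<psi> = (\<lambda>n c t. real (Suc n) * tent (real (Suc n) * (t - c)))"
  have D: "(\<phi> n has_real_derivative \<psi> n a t - \<psi> n b t) (at t)" for n t
    unfolding \<phi>_def \<psi>_def
    by (rule derivative_eq_intros DERIV_chain2[OF DERIV_step] refl)+ simp
  have dphi: "deriv (\<phi> n) t = \<psi> n a t - \<psi> n b t" for n t
    by (rule DERIV_imp_deriv[OF D])
  have psic: "continuous_on A (\<psi> n c)" for A n c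
    unfolding \<psi>_def
    by (rule continuous_on_mult[OF continuous_on_const continuous_on_compose2[OF continuous_tent[of UNIV]]])
      (auto intro!: continuous_intros)
  have [measurable]: "step \<in> borel_measurable borel"
    by (rule borel_measurable_continuous_onI, rule DERIV_continuous_on, rule has_field_derivative_at_within, rule DERIV_step)
  have L: "(\<lambda>n. LINT t|?M. deriv (\<phi> n) t *\<^sub>R w t) \<longlonglongrightarrow> w a - w b"
  proof -
    have i: "integrable ?M (\<lambda>t. \<psi> n c t *\<^sub>R w t)" for n c
      by (rule continuous_imp_integrable_real[OF continuous_on_scaleR[OF psic w]])
    have "(LINT t|?M. deriv (\<phi> n) t *\<^sub>R w t) = (LINT t|?M. \<psi> n a t *\<^sub>R w t) - (LINT t|?M. \<psi> n b t *\<^sub>R w t)" for n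
      unfolding dphi scaleR_diff_left by (intro Bochner_Integration.integral_diff i)
    moreover have "(\<lambda>n. (LINT t|?M. \<psi> n a t *\<^sub>R w t) - (LINT t|?M. \<psi> n b t *\<^sub>R w t)) \<longlonglongrightarrow> w a - w b"
      unfolding \<psi>_def using ab by (intro tendsto_diff tent_approximates_delta[OF w]) auto
    ultimately show ?thesis by simp
  qed
  have R: "(\<lambda>n. LINT t|?M. \<phi> n t *\<^sub>R g t) \<longlonglongrightarrow> (LINT t|?M. ((if a < t then 1 else 0) - (if b < t then 1 else 0)) *\<^sub>R g t)"
  proof (rule integral_dominated_convergence)
    show "integrable ?M (\<lambda>t. 1 * norm (g t))" using gi by simp
    show "(\<lambda>t. \<phi> n t *\<^sub>R g t) \<in> borel_measurable ?M" for n
      unfolding \<phi>_def by measurable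
    show "(\<lambda>t. ((if a < t then 1 else 0) - (if b < t then 1 else 0)) *\<^sub>R g t) \<in> borel_measurable ?M"
      by measurable
    have "(\<lambda>n. \<phi> n t) \<longlonglongrightarrow> (if a < t then 1 else 0) - (if b < t then 1 else 0)" for t
      using tendsto_diff[OF step_tendsto[of "t - a"] step_tendsto[of "t - b"]] by (simp add: \<phi>_def)
    then show "AE t in ?M. (\<lambda>n. \<phi> n t *\<^sub>R g t) \<longlonglongrightarrow> ((if a < t then 1 else 0) - (if b < t then 1 else 0)) *\<^sub>R g t"
      by (intro AE_I2 tendsto_intros)
    have "\<bar>\<phi> n t\<bar> \<le> 1" for n t
      unfolding \<phi>_def using step_bounds[of "real (Suc n) * (t - a)"] step_bounds[of "real (Suc n) * (t - b)"] by linarith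
    then show "AE t in ?M. norm (\<phi> n t *\<^sub>R g t) \<le> 1 * norm (g t)" for n
      by (intro AE_I2) (simp add: mult_left_le_one_le)
  qed
  have "\<forall>\<^sub>F n in sequentially. 2 / (T - b) < real (Suc n)"
    using filterlim_compose[OF filterlim_real_sequentially filterlim_Suc] by (simp add: filterlim_at_top_dense)
  then have "\<forall>\<^sub>F n in sequentially. - (LINT t|?M. \<phi> n t *\<^sub>R g t) = (LINT t|?M. deriv (\<phi> n) t *\<^sub>R w t)"
  proof eventually_elim
    case (elim n)
    define N where "N = real (Suc n)"
    have N: "0 < N" "2 / N < T - b" using elim ab by (simp_all add: N_def field_simps)
    have "test_function T (\<phi> n)"
      unfolding test_function_def
    proof
      show "\<phi> n C1_differentiable_on UNIV"
        unfolding C1_differentiable_on_def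
      proof (intro exI conjI ballI)
        show "(\<phi> n has_vector_derivative \<psi> n a t - \<psi> n b t) (at t)" for t
          using D by (simp add: has_real_derivative_iff_has_vector_derivative)
        show "continuous_on UNIV (\<lambda>t. \<psi> n a t - \<psi> n b t)"
          by (intro continuous_intros psic)
      qed
      have "\<phi> n t = 0" if "t \<notin> {a..b + 2 / N}" for t
      proof (cases "t < a")
        case True
        then show ?thesis using N ab
          by (auto simp: \<phi>_def step_eq_0 mult_le_0_iff simp flip: N_def)
      next
        case False
        then have t: "2 / N < t - b" using that by auto
        then have "2 \<le> N * (t - b)" using N by (simp add: field_simps)
        moreover have "N * (t - b) \<le> N * (t - a)" using N ab by (intro mult_left_mono) auto
        ultimately show ?thesis unfolding \<phi>_def N_def[symmetric] by (simp add: step_eq_1)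
      qed
      then show "\<exists>K. compact K \<and> K \<subseteq> {0<..<T} \<and> (\<forall>t. t \<notin> K \<longrightarrow> \<phi> n t = 0)"
        using ab N by (intro exI[of _ "{a..b + 2 / N}"]) auto
    qed
    from tf[OF this] show ?case by simp
  qed
  from Lim_transform_eventually[OF tendsto_minus[OF R] this]
  have "- (LINT t|?M. ((if a < t then 1 else 0) - (if b < t then 1 else 0)) *\<^sub>R g t) = w a - w b"
    using L LIMSEQ_unique by blast
  moreover have "(\<lambda>t. ((if a < t then 1 else 0) - (if b < t then 1 else 0)) *\<^sub>R g t) = (\<lambda>t. if a < t \<and> t \<le> b then g t else 0)"
    using ab by auto
  ultimately show ?thesis by (simp add: minus_equation_iff[of _ "w a - w b"])
qed

text \<open>The increments show that the integral of \<open>g\<close> minus \<open>w\<close> is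
  constant inside (0,T); continuity of both extends this to the endpoints.\<close>

lemma weak_derivative_imp_integral:
  fixes w :: "real \<Rightarrow> real^'m"
  assumes wd: "has_weak_derivative T w g" and w: "continuous_on {0..T} w" and t: "t \<in> {0..T}" and T: "0 < T"
  shows "(LINT s|lebesgue_on {0..t}. g s) = w t - w 0"
proof -
  let ?M = "lebesgue_on {0..T}"
  define W where "W = (\<lambda>t. LINT s|lebesgue_on {0..t}. g s)"
  have gi: "integrable ?M g" using wd by (simp add: has_weak_derivative_iff)
  have [measurable]: "g \<in> borel_measurable ?M" using gi by auto
  have "(\<lambda>s. s) \<in> borel_measurable ?M" by (rule borel_measurable_lebesgue_onI) simp
  note [measurable] = this
  have Wc: "continuous_on {0..T} W"
    unfolding W_def by (rule indefinite_integral_continuous_real[OF gi])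
  have i: "integrable ?M (\<lambda>s. if s \<le> c then g s else 0)" for c
    by (rule Bochner_Integration.integrable_bound[OF gi]) auto
  have eq: "W b - w b = W a - w a" if ab: "0 < a" "a < b" "b < T" for a b
  proof -
    have "W b - W a = (LINT s|?M. (if s \<le> b then g s else 0) - (if s \<le> a then g s else 0))"
      unfolding W_def using ab i
      by (subst (1 2) integral_upto[where T = T, symmetric]) (auto simp: Bochner_Integration.integral_diff)
    also have "(\<lambda>s. (if s \<le> b then g s else 0) - (if s \<le> a then g s else 0)) = (\<lambda>s. if a < s \<and> s \<le> b then g s else 0)"
      using ab by auto
    finally show ?thesis using weak_derivative_increment[OF wd w ab] by (simp add: algebra_simps)
  qed
  define h where "h = (\<lambda>t. W t - w t)"
  have hT: "h s = h (T / 2)" if "s \<in> {0<..<T}" for s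
    using eq[of s "T / 2"] eq[of "T / 2" s] that T by (cases s "T / 2" rule: linorder_cases) (auto simp: h_def)
  have clos: "closure {0<..<T} = {0..T}" using T by simp
  have "continuous_on (closure {0<..<T}) h"
    unfolding clos h_def by (rule continuous_on_diff[OF Wc w])
  from continuous_constant_on_closure[OF this hT] have "h s = h (T / 2)" if "s \<in> {0..T}" for s
    using that unfolding clos by blast
  from this[of t] this[of 0] have "h t = h 0" using t T by simp
  moreover have "W 0 = 0"
  proof -
    have "(LINT s|lebesgue_on {0..0::real}. g s) = integral {0..0} g"
      using integrable_subinterval[OF gi, of 0 0] T by (intro lebesgue_integral_eq_integral) auto
    then show ?thesis by (simp add: W_def)
  qed
  ultimately show ?thesis unfolding h_def W_def by (simp add: algebra_simps)
qed

text \<open>Lebesgue differentiation: outside a negligible set the averages over [x, x + k] tend to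
  the value at x, and here these averages are 0. Extension by zero provides a function on the whole
  line.\<close>

lemma integral_zero_imp_AE_zero:
  fixes g :: "real \<Rightarrow> 'b::euclidean_space"
  assumes gi: "integrable (lebesgue_on {0..T}) g"
    and z: "\<And>t. t \<in> {0..T} \<Longrightarrow> (LINT s|lebesgue_on {0..t}. g s) = 0"
  shows "AE t in lebesgue_on {0..T}. g t = 0"
proof -
  define h where "h = (\<lambda>x. if x \<in> {0..T} then g x else 0)"
  have "h integrable_on cbox a b" for a b
  proof -
    have "g integrable_on {0..T}" using gi by (rule integrable_on_lebesgue_on) simp
    then have "h integrable_on UNIV" unfolding h_def by (simp only: Henstock_Kurzweil_Integration.integrable_restrict_UNIV)
    then show ?thesis by (rule integrable_on_subcbox) simp
  qed
  then obtain N where N: "negligible N" "\<And>x e. \<lbrakk>x \<notin> N; 0 < e\<rbrakk> \<Longrightarrow>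
    \<exists>d>0. \<forall>k. 0 < k \<and> k < d \<longrightarrow> norm (integral (cbox x (x + k *\<^sub>R One)) h /\<^sub>R k ^ DIM(real) - h x) < e"
    by (rule integrable_ccontinuous_explicit) blast
  have "g x = 0" if x: "0 < x" "x < T" "x \<notin> N" for x
  proof (rule ccontr)
    assume "g x \<noteq> 0"
    then have "0 < norm (g x)" by simp
    from N(2)[OF x(3) this] obtain d where d: "d > 0" "\<And>k. 0 < k \<Longrightarrow> k < d \<Longrightarrow> norm (integral (cbox x (x + k *\<^sub>R One)) h /\<^sub>R k ^ DIM(real) - h x) < norm (g x)"
      by blast
    \<comment> \<open>The bound T - x keeps [x, x + k] inside [0,T], where \<open>h\<close> equals
      \<open>g\<close>.\<close>
    define k where "k = min (d / 2) (T - x)"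
    have k: "0 < k" "k < d" "x + k \<le> T" using d x by (auto simp: k_def)
    have I: "integral {0..t} g = 0" if "t \<in> {0..T}" for t
      using z[OF that] integrable_subinterval[OF gi, of 0 t] that by (simp add: lebesgue_integral_eq_integral)
    have gint: "g integrable_on {0..x + k}"
      using integrable_subinterval[OF gi, of 0 "x + k"] k by (intro integrable_on_lebesgue_on) auto
    have "integral {0..x} g + integral {x..x + k} g = integral {0..x + k} g"
      using k x gint by (intro Henstock_Kurzweil_Integration.integral_combine) auto
    then have "integral {x..x + k} g = 0" using I k x by simp
    moreover have "integral {x..x + k} h = integral {x..x + k} g"
      using k x by (intro integral_cong) (auto simp: h_def)
    ultimately have "norm (h x) < norm (g x)" using d(2)[OF k(1,2)] by simp
    then show False using x by (simp add: h_def)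
  qed
  moreover have "AE x in lebesgue. x \<notin> N"
    using N(1) by (simp add: AE_not_in negligible_iff_null_sets)
  then have "AE x in lebesgue_on {0..T}. x \<notin> N"
    by (simp add: AE_restrict_space_iff) (rule AE_mp, auto)
  moreover have "AE x in lebesgue_on {0..T}. x \<noteq> 0" "AE x in lebesgue_on {0..T}. x \<noteq> T"
    by (auto intro: AE_lebesgue_on_neq)
  ultimately show ?thesis
    by (auto elim!: eventually_elim2 simp: AE_restrict_space_iff)
qed

text \<open>Makes the choice hidden in \<open>weak_derivative\<close> harmless almost everywhere:
  two candidates have the same integral over every [0,t].\<close>

lemma weak_derivative_unique:
  fixes w :: "real \<Rightarrow> real^'m"
  assumes "has_weak_derivative T w g" "has_weak_derivative T w h" "continuous_on {0..T} w" "0 < T"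
  shows "AE t in lebesgue_on {0..T}. g t = h t"
proof -
  have gi: "integrable (lebesgue_on {0..T}) g" "integrable (lebesgue_on {0..T}) h"
    using assms by (auto simp: has_weak_derivative_iff)
  have "(LINT s|lebesgue_on {0..t}. g s - h s) = 0" if "t \<in> {0..T}" for t
    using assms that integrable_subinterval[OF gi(1), of 0 t] integrable_subinterval[OF gi(2), of 0 t]
    by (simp add: weak_derivative_imp_integral)
  then have "AE t in lebesgue_on {0..T}. g t - h t = 0"
    using gi by (intro integral_zero_imp_AE_zero) auto
  then show ?thesis by simp
qed

section \<open>Equivalence with the Volterra equation\<close>

lemma rl_integral_integral:
  fixes f :: "real \<Rightarrow> real^'m"
  assumes ab: "0 < a" "0 < b" "a + b = 1" and t: "t \<in> {0..T}"
    and f: "integrable (lebesgue_on {0..T}) f"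
  shows "rl_integral a (rl_integral b f) t = (LINT s|lebesgue_on {0..t}. f s)"
proof -
  have G: "0 < Gamma a" "0 < Gamma b" using ab by (auto intro: Gamma_real_pos)
  have "rl_integral a (rl_integral b f) t = (1 / Gamma a) *\<^sub>R (LINT \<tau>|lebesgue_on {0..T}. kern a T (t - \<tau>) *\<^sub>R rl_integral b f \<tau>)"
    by (rule rl_integral_kern[OF t])
  also have "(LINT \<tau>|lebesgue_on {0..T}. kern a T (t - \<tau>) *\<^sub>R rl_integral b f \<tau>)
    = (LINT \<tau>|lebesgue_on {0..T}. (1 / Gamma b) *\<^sub>R (kern a T (t - \<tau>) *\<^sub>R (LINT s|lebesgue_on {0..T}. kern b T (\<tau> - s) *\<^sub>R f s)))"
    by (intro Bochner_Integration.integral_cong) (auto simp: rl_integral_kern)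
  also have "\<dots> = (1 / Gamma b) *\<^sub>R ((Gamma a * Gamma b) *\<^sub>R (LINT s|lebesgue_on {0..t}. f s))"
    unfolding integral_scaleR_right kern_semigroup[OF ab t f] ..
  finally show ?thesis using G by simp
qed

lemma continuous_on_powr_integrable:
  fixes f :: "real \<Rightarrow> 'b::euclidean_space"
  assumes "continuous_on {0..T} f" "0 \<le> p"
  shows "f \<in> borel_measurable (lebesgue_on {0..T})" "integrable (lebesgue_on {0..T}) (\<lambda>s. norm (f s) powr p)"
proof -
  show m [measurable]: "f \<in> borel_measurable (lebesgue_on {0..T})"
    using continuous_imp_integrable_real[OF assms(1)] by auto
  have "bounded (f ` {0..T})"
    by (intro compact_imp_bounded compact_continuous_image assms) auto
  then obtain B where B: "\<And>t. t \<in> {0..T} \<Longrightarrow> norm (f t) \<le> B"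
    unfolding bounded_iff by (metis imageI)
  interpret finite_measure "lebesgue_on {0..T}" by (rule finite_measure_lebesgue_on_Icc)
  show "integrable (lebesgue_on {0..T}) (\<lambda>s. norm (f s) powr p)"
  proof (rule integrable_const_bound[of _ "B powr p"])
    show "AE x in lebesgue_on {0..T}. norm (norm (f x) powr p) \<le> B powr p"
      using B assms(2) by (intro AE_I2) (auto intro!: powr_mono2)
  qed measurable
qed

lemma rl_integral_continuous:
  fixes f :: "real \<Rightarrow> real^'m"
  assumes p: "1 < p" "1 / p < b" "b \<le> 1" and "0 \<le> T"
    and f: "f \<in> borel_measurable (lebesgue_on {0..T})"
    and fp: "integrable (lebesgue_on {0..T}) (\<lambda>s. norm (f s) powr p)"
  shows "continuous_on {0..T} (rl_integral b f)"
proof -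
  have "continuous_on {0..T} (\<lambda>t. (1 / Gamma b) *\<^sub>R (LINT s|lebesgue_on {0..T}. kern b T (t - s) *\<^sub>R f s))"
    by (intro continuous_on_scaleR continuous_on_const conv_continuous[OF assms])
  then show ?thesis by (rule continuous_on_eq) (simp add: rl_integral_kern[where T = T])
qed

text \<open>Needed for the order 1 - \<alpha>, which need not exceed 1/p. A bounded function lies in
  every L^p, so the exponent 2 / b, larger than 1 and than 1 / b, can be used instead.\<close>

lemma rl_integral_continuous_on:
  fixes f :: "real \<Rightarrow> real^'m"
  assumes b: "0 < b" "b \<le> 1" and "0 \<le> T" and f: "continuous_on {0..T} f"
  shows "continuous_on {0..T} (rl_integral b f)"
    and "t \<in> {0..T} \<Longrightarrow> integrable (lebesgue_on {0..T}) (\<lambda>s. kern b T (t - s) *\<^sub>R f s)"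
proof -
  have p: "1 < 2 / b" "1 / (2 / b) < b" using b by (auto simp: field_simps)
  then have "0 \<le> 2 / b" by simp
  note B = continuous_on_powr_integrable[OF f this]
  show "continuous_on {0..T} (rl_integral b f)"
    by (rule rl_integral_continuous[OF p b(2) \<open>0 \<le> T\<close> B])
  show "integrable (lebesgue_on {0..T}) (\<lambda>s. kern b T (t - s) *\<^sub>R f s)" if "t \<in> {0..T}"
    by (rule conv_integrable(1)[OF p \<open>0 \<le> T\<close> B])
qed

lemma rl_integral_0: "rl_integral b f 0 = 0"
proof -
  have "(LINT s|lebesgue_on {0..0::real}. (0 - s) powr (b - 1) *\<^sub>R f s) = (LINT s|lebesgue_on {0..0::real}. 0)"
    by (intro Bochner_Integration.integral_cong) auto
  then show ?thesis by (simp add: rl_integral_def)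
qed

lemma has_weak_derivative_cong:
  assumes "\<And>t. t \<in> {0..T} \<Longrightarrow> f t = f' t" "has_weak_derivative T f g"
  shows "has_weak_derivative T f' g"
proof -
  have "integrable (lebesgue_on {0..T}) f = integrable (lebesgue_on {0..T}) f'"
    using assms(1) by (intro Bochner_Integration.integrable_cong) auto
  moreover have "(LINT t|lebesgue_on {0..T}. c t *\<^sub>R f t) = (LINT t|lebesgue_on {0..T}. c t *\<^sub>R f' t)" for c :: "real \<Rightarrow> real"
    using assms(1) by (intro Bochner_Integration.integral_cong) auto
  ultimately show ?thesis using assms(2) unfolding has_weak_derivative_iff by simp
qed

text \<open>Lets the right-hand side of the equation replace the arbitrarily chosen derivative
  \<open>caputo\<close>.\<close>

lemma has_weak_derivative_AE:
  assumes "AE t in lebesgue_on {0..T}. g t = g' t" "has_weak_derivative T f g"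
    and [measurable]: "g' \<in> borel_measurable (lebesgue_on {0..T})" and T: "0 < T"
  shows "has_weak_derivative T f g'"
proof -
  let ?M = "lebesgue_on {0..T}"
  have g: "integrable ?M g" using assms by (simp add: has_weak_derivative_iff)
  then have [measurable]: "g \<in> borel_measurable ?M" by auto
  have "integrable ?M g'" using g assms(1) by (subst integrable_cong_AE[where g = g]) auto
  moreover have "(LINT t|?M. \<phi> t *\<^sub>R g t) = (LINT t|?M. \<phi> t *\<^sub>R g' t)" if "test_function T \<phi>" for \<phi>
  proof (rule integral_cong_AE)
    have "\<phi> \<in> borel_measurable borel"
      using test_functionD(1)[OF that T]
      by (intro borel_measurable_continuous_onI continuous_at_imp_continuous_on ballI) (metis has_vector_derivative_continuous)
    from borel_measurable_lebesgue_onI[OF this]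
    have [measurable]: "\<phi> \<in> borel_measurable ?M" .
    show "(\<lambda>t. \<phi> t *\<^sub>R g t) \<in> borel_measurable ?M" "(\<lambda>t. \<phi> t *\<^sub>R g' t) \<in> borel_measurable ?M"
      by measurable
    show "AE t in ?M. \<phi> t *\<^sub>R g t = \<phi> t *\<^sub>R g' t"
      using assms(1) by eventually_elim simp
  qed
  ultimately show ?thesis using assms(2) unfolding has_weak_derivative_iff by simp
qed

lemma has_weak_derivative_diff:
  fixes f f' :: "real \<Rightarrow> real^'m"
  assumes "has_weak_derivative T f g" "has_weak_derivative T f' g'" "0 < T"
  shows "has_weak_derivative T (\<lambda>t. f t - f' t) (\<lambda>t. g t - g' t)"
proof -
  let ?M = "lebesgue_on {0..T}"
  have i: "integrable ?M f" "integrable ?M f'" "integrable ?M g" "integrable ?M g'"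
    using assms by (auto simp: has_weak_derivative_iff)
  have mult: "integrable ?M (\<lambda>t. c t *\<^sub>R h t)" if c: "continuous_on UNIV c" and h: "integrable ?M h"
    for c and h :: "real \<Rightarrow> real^'m"
  proof -
    have "bounded (c ` {0..T})"
      by (intro compact_imp_bounded compact_continuous_image continuous_on_subset[OF c]) auto
    then obtain B where B: "\<And>t. t \<in> {0..T} \<Longrightarrow> \<bar>c t\<bar> \<le> B"
      unfolding bounded_iff by (metis imageI real_norm_def)
    have B0: "0 \<le> B" using B[of 0] assms(3) by auto
    have [measurable]: "h \<in> borel_measurable ?M" using h by auto
    have [measurable]: "c \<in> borel_measurable ?M"
      by (intro borel_measurable_lebesgue_onI borel_measurable_continuous_onI c)
    show ?thesis
    proof (rule Bochner_Integration.integrable_bound)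
      show "integrable ?M (\<lambda>t. B *\<^sub>R h t)" using h by auto
      show "AE t in ?M. norm (c t *\<^sub>R h t) \<le> norm (B *\<^sub>R h t)"
        using B B0 by (intro AE_I2) (auto intro!: mult_right_mono)
    qed measurable
  qed
  have "(LINT t|?M. deriv \<phi> t *\<^sub>R (f t - f' t)) = - (LINT t|?M. \<phi> t *\<^sub>R (g t - g' t))" if \<phi>: "test_function T \<phi>" for \<phi>
  proof -
    note D = test_functionD[OF \<phi> assms(3)]
    have c: "continuous_on UNIV \<phi>"
      using D(1) by (intro continuous_at_imp_continuous_on ballI) (metis has_vector_derivative_continuous)
    show ?thesis
      using assms(1,2) \<phi> unfolding has_weak_derivative_iff
      by (simp add: scaleR_diff_right Bochner_Integration.integral_diff mult[OF D(2)] mult[OF c] i)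
  qed
  then show ?thesis using i unfolding has_weak_derivative_iff by auto
qed

lemma has_weak_derivative_uminus:
  assumes "has_weak_derivative T f g"
  shows "has_weak_derivative T (\<lambda>t. - f t) (\<lambda>t. - g t)"
  using assms unfolding has_weak_derivative_iff by (auto simp: integral_minus)

lemma has_weak_derivative_add:
  fixes f f' :: "real \<Rightarrow> real^'m"
  assumes "has_weak_derivative T f g" "has_weak_derivative T f' g'" "0 < T"
  shows "has_weak_derivative T (\<lambda>t. f t + f' t) (\<lambda>t. g t + g' t)"
  using has_weak_derivative_diff[OF assms(1) has_weak_derivative_uminus[OF assms(2)] assms(3)] by simp

text \<open>\<open>caputo_defined\<close> speaks about v, but \<open>caputo\<close> differentiates
  J^(1-\<alpha>) of v - v 0; the difference is this function. Reflecting s to t - s exhibits it as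
  an indefinite integral of the kernel.\<close>

lemma rl_integral_const_W11:
  fixes c :: "real^'m"
  assumes b: "0 < b" "b < 1" and T: "0 < T"
  shows "in_W11 T (rl_integral b (\<lambda>_. c))"
proof -
  have ki: "integrable lebesgue (kern b T)" using b T by (intro kern_integral) auto
  have k: "integrable (lebesgue_on {0..T}) (\<lambda>s. (kern b T s / Gamma b) *\<^sub>R c)"
    using ki by (intro integrable_scaleR_left integrable_divide) (auto simp: integrable_restrict_space intro: integrable_mult_indicator[where 'b = real, simplified])
  have "rl_integral b (\<lambda>_. c) t = (LINT s|lebesgue_on {0..t}. (kern b T s / Gamma b) *\<^sub>R c)" if t: "t \<in> {0..T}" for t
  proof -
    \<comment> \<open>A reflection followed by a translation by t amounts to s -> t - s.\<close>
    have "(LINT s|lebesgue_on {0..t}. kern b T s *\<^sub>R c) = (LINT s|lebesgue_on {-t..-0}. kern b T (- s) *\<^sub>R c)"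
      by (rule integral_reflect_real[symmetric])
    also have "\<dots> = (LINT s|lebesgue. (if s \<in> {-t..0} then kern b T (- s) *\<^sub>R c else 0))"
      by (subst Lebesgue_Measure.integral_restrict_UNIV) auto
    also have "\<dots> = (LINT s|lebesgue. (if - t + 1 * s \<in> {-t..0} then kern b T (- (- t + 1 * s)) *\<^sub>R c else 0))"
      by (subst lebesgue_integral_real_affine[of 1 _ "-t"]) auto
    also have "\<dots> = (LINT s|lebesgue. (if s \<in> {0..t} then (t - s) powr (b - 1) *\<^sub>R c else 0))"
      using t by (intro Bochner_Integration.integral_cong) (auto simp: kern_def)
    also have "\<dots> = (LINT s|lebesgue_on {0..t}. (t - s) powr (b - 1) *\<^sub>R c)"
      by (subst Lebesgue_Measure.integral_restrict_UNIV) auto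
    finally have "rl_integral b (\<lambda>_. c) t = (1 / Gamma b) *\<^sub>R (LINT s|lebesgue_on {0..t}. kern b T s *\<^sub>R c)"
      by (simp add: rl_integral_def)
    then show ?thesis by (simp flip: integral_scaleR_right add: divide_inverse mult.commute)
  qed
  from has_weak_derivative_integral[OF T k this] show ?thesis
    unfolding in_W11_def by blast
qed

text \<open>\<open>f\<close> is left free of \<phi>, so the statement is linear;
  \<open>H s (u s)\<close> is inserted later. Left to right, w = J^(1-\<alpha>)(\<phi> - \<phi> 0)
  equals the integral of \<open>f\<close>, that is J^(1-\<alpha>) J^\<alpha> f, and J^(1-\<alpha>)
  is cancelled. Right to left, \<open>f\<close> is a weak derivative of w, and uniqueness identifies
  it with \<open>caputo\<close>.\<close>

lemma volterra_equivalence: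
  fixes \<phi> :: "real \<Rightarrow> real^'m"
  assumes T: "0 < T" and p: "1 < p" "1 / p < \<alpha>" "\<alpha> < 1"
    and c: "continuous_on {0..T} \<phi>"
    and f: "f \<in> borel_measurable (lebesgue_on {0..T})"
    and fp: "integrable (lebesgue_on {0..T}) (\<lambda>s. norm (f s) powr p)"
  shows "caputo_defined \<alpha> T \<phi> \<and> (AE t in lebesgue_on {0..T}. caputo \<alpha> T \<phi> t = f t) \<longleftrightarrow>
    (\<forall>t\<in>{0..T}. \<phi> t = \<phi> 0 + rl_integral \<alpha> f t)"
proof -
  let ?M = "lebesgue_on {0..T}"
  have T0: "0 \<le> T" using T by simp
  have "0 < 1 / p" using p by simp
  then have \<alpha>: "0 < \<alpha>" using p by linarith
  have b: "0 < 1 - \<alpha>" "1 - \<alpha> < 1" "1 - \<alpha> \<le> 1" "\<alpha> \<le> 1" using p \<alpha> by auto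
  have fi: "integrable ?M f" using powr_integrable_imp_integrable[OF _ f fp] p by simp
  define w where "w = rl_integral (1 - \<alpha>) (\<lambda>s. \<phi> s - \<phi> 0)"
  have cd: "continuous_on {0..T} (\<lambda>s. \<phi> s - \<phi> 0)"
    using c by (intro continuous_intros)
  have wc: "continuous_on {0..T} w"
    unfolding w_def by (rule rl_integral_continuous_on(1)[OF b(1,3) T0 cd])
  have w0: "w 0 = 0" unfolding w_def by (rule rl_integral_0)
  have split: "rl_integral (1 - \<alpha>) \<phi> t - rl_integral (1 - \<alpha>) (\<lambda>_. \<phi> 0) t = w t" if "t \<in> {0..T}" for t
    unfolding w_def rl_integral_kern[OF that] scaleR_diff_right
    using rl_integral_continuous_on(2)[OF b(1,3) T0 c that] rl_integral_continuous_on(2)[OF b(1,3) T0 continuous_on_const[of _ "\<phi> 0"] that]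
    by (simp add: Bochner_Integration.integral_diff scaleR_diff_right)
  obtain k where k: "has_weak_derivative T (rl_integral (1 - \<alpha>) (\<lambda>_. \<phi> 0)) k"
    using rl_integral_const_W11[OF b(1,2) T, of "\<phi> 0"] unfolding in_W11_def by blast
  have W: "in_W11 T (rl_integral (1 - \<alpha>) \<phi>) \<longleftrightarrow> in_W11 T w"
  proof
    assume "in_W11 T (rl_integral (1 - \<alpha>) \<phi>)"
    then obtain g where "has_weak_derivative T (rl_integral (1 - \<alpha>) \<phi>) g" unfolding in_W11_def by blast
    from has_weak_derivative_cong[OF split has_weak_derivative_diff[OF this k T]]
    show "in_W11 T w" unfolding in_W11_def by blast
  next
    assume "in_W11 T w"
    then obtain g where g: "has_weak_derivative T w g" unfolding in_W11_def by blast
    have "w t + rl_integral (1 - \<alpha>) (\<lambda>_. \<phi> 0) t = rl_integral (1 - \<alpha>) \<phi> t" if "t \<in> {0..T}" for t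
      using split[OF that] by (simp add: algebra_simps)
    from has_weak_derivative_cong[OF this has_weak_derivative_add[OF g k T]]
    show "in_W11 T (rl_integral (1 - \<alpha>) \<phi>)" unfolding in_W11_def by blast
  qed
  have cap: "has_weak_derivative T w (caputo \<alpha> T \<phi>)" if "in_W11 T w"
    using that unfolding caputo_def weak_derivative_def in_W11_def w_def[symmetric] by (rule someI_ex)
  have Jf: "rl_integral (1 - \<alpha>) (rl_integral \<alpha> f) t = (LINT s|lebesgue_on {0..t}. f s)" if "t \<in> {0..T}" for t
    using rl_integral_integral[OF b(1) \<alpha> _ that fi] by simp
  have Jc: "continuous_on {0..T} (rl_integral \<alpha> f)"
    by (rule rl_integral_continuous[OF p(1,2) b(4) T0 f fp])
  show ?thesis
  proof
    assume L: "caputo_defined \<alpha> T \<phi> \<and> (AE t in ?M. caputo \<alpha> T \<phi> t = f t)"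
    then have "has_weak_derivative T w (caputo \<alpha> T \<phi>)"
      using W cap unfolding caputo_defined_def by blast
    from has_weak_derivative_AE[OF conjunct2[OF L] this f T]
    have wf: "has_weak_derivative T w f" .
    \<comment> \<open>\<open>J\<^sub>t\<^sup>1\<^sup>-\<^sup>\<alpha>\<close> is injective on continuous functions because \<open>J\<^sub>t\<^sup>\<alpha>\<close> turns it into plain integration.\<close>
    define d where "d = (\<lambda>s. (\<phi> s - \<phi> 0) - rl_integral \<alpha> f s)"
    have dc: "continuous_on {0..T} d" unfolding d_def by (intro continuous_on_diff cd Jc)
    have Jd: "rl_integral (1 - \<alpha>) d t = 0" if t: "t \<in> {0..T}" for t
    proof -
      have "rl_integral (1 - \<alpha>) d t = w t - rl_integral (1 - \<alpha>) (rl_integral \<alpha> f) t"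
        unfolding w_def d_def rl_integral_kern[OF t]
        using rl_integral_continuous_on(2)[OF b(1,3) T0 cd t] rl_integral_continuous_on(2)[OF b(1,3) T0 Jc t]
        by (simp add: scaleR_diff_right Bochner_Integration.integral_diff)
      also have "\<dots> = 0"
        using weak_derivative_imp_integral[OF wf wc t T] Jf[OF t] w0 by simp
      finally show ?thesis .
    qed
    have di: "integrable ?M d" by (rule continuous_imp_integrable_real[OF dc])
    have Id: "integral {0..t} d = 0" if t: "t \<in> {0..T}" for t
    proof -
      have "(LINT s|lebesgue_on {0..t}. d s) = rl_integral \<alpha> (rl_integral (1 - \<alpha>) d) t"
        using rl_integral_integral[OF \<alpha> b(1) _ t di] by simp
      also have "\<dots> = 0"
        unfolding rl_integral_kern[OF t]
        by (subst Bochner_Integration.integral_cong[where g = "\<lambda>_. 0"]) (auto simp: Jd)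
      finally show ?thesis
        using integrable_subinterval[OF di, of 0 t] t by (simp add: lebesgue_integral_eq_integral)
    qed
    \<comment> \<open>\<open>d\<close> is continuous, so its indefinite integral has derivative
      \<open>d t\<close> at every t, one-sided at the ends. Hence \<open>d\<close> vanishes
      everywhere and not only almost everywhere.\<close>
    have "d t = 0" if t: "t \<in> {0..T}" for t
    proof (rule vector_derivative_unique_within_closed_interval[of 0 T t])
      show "((\<lambda>u. integral {0..u} d) has_vector_derivative d t) (at t within cbox 0 T)"
        using integral_has_vector_derivative[OF dc t] by simp
      have "((\<lambda>u. 0) has_vector_derivative 0) (at t within {0..T})" by simp
      from has_vector_derivative_transform[where g = "\<lambda>u. integral {0..u} d", OF t Id this]
      show "((\<lambda>u. integral {0..u} d) has_vector_derivative 0) (at t within cbox 0 T)"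
        unfolding cbox_interval .
    qed (use T t in auto)
    then show "\<forall>t\<in>{0..T}. \<phi> t = \<phi> 0 + rl_integral \<alpha> f t"
      unfolding d_def by (metis diff_add_cancel add.commute eq_iff_diff_eq_0)
  next
    assume R: "\<forall>t\<in>{0..T}. \<phi> t = \<phi> 0 + rl_integral \<alpha> f t"
    have R': "\<phi> s - \<phi> 0 = rl_integral \<alpha> f s" if "s \<in> {0..T}" for s
      using bspec[OF R that] by (metis add_diff_cancel_left')
    have wt: "w t = (LINT s|lebesgue_on {0..t}. f s)" if t: "t \<in> {0..T}" for t
    proof -
      have "w t = rl_integral (1 - \<alpha>) (rl_integral \<alpha> f) t"
        unfolding w_def rl_integral_kern[OF t]
        by (subst Bochner_Integration.integral_cong[OF refl]) (auto simp: R')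
      then show ?thesis using Jf[OF t] by simp
    qed
    have wf: "has_weak_derivative T w f"
      by (rule has_weak_derivative_integral[OF T fi wt])
    then have "in_W11 T w" unfolding in_W11_def by blast
    then show "caputo_defined \<alpha> T \<phi> \<and> (AE t in ?M. caputo \<alpha> T \<phi> t = f t)"
      using W c weak_derivative_unique[OF cap wf wc T] unfolding caputo_defined_def by simp
  qed
qed

section \<open>The Volterra equation with Lipschitz right-hand side\<close>

text \<open>Sampling \<open>u\<close> at multiples of 1/N leaves countably many arguments, so
  measurability in t for fixed x suffices; continuity of \<open>H t\<close> carries it to the
  limit.\<close>

lemma caratheodory_composition_measurable:
  fixes H :: "real \<Rightarrow> 'a::euclidean_space \<Rightarrow> 'b::euclidean_space"
  assumes H: "\<And>x. (\<lambda>t. H t x) \<in> borel_measurable (lebesgue_on {0..T})"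
    and Hc: "\<And>t. t \<in> {0..T} \<Longrightarrow> continuous_on UNIV (H t)"
    and u: "continuous_on {0..T} u"
  shows "(\<lambda>t. H t (u t)) \<in> borel_measurable (lebesgue_on {0..T})"
proof (rule borel_measurable_LIMSEQ_metric)
  \<comment> \<open>Rounding down keeps the sample points of t \<in> [0,T] inside [0,T], where
    \<open>u\<close> is continuous.\<close>
  let ?r = "\<lambda>n t. real_of_int \<lfloor>real (Suc n) * t\<rfloor> / real (Suc n)"
  show "(\<lambda>t. H t (u (?r n t))) \<in> borel_measurable (lebesgue_on {0..T})" for n
  proof (rule measurable_compose_countable[where f = "\<lambda>i t. H t (u (real_of_int i / real (Suc n)))"])
    show "(\<lambda>t. \<lfloor>real (Suc n) * t\<rfloor>) \<in> measurable (lebesgue_on {0..T}) (count_space UNIV)"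
      by (rule measurable_compose[OF borel_measurable_lebesgue_onI measurable_real_floor]) measurable
  qed (rule H)
  fix t assume "t \<in> space (lebesgue_on {0..T})"
  then have t: "t \<in> {0..T}" by simp
  have r: "t - 1 / real (Suc n) \<le> ?r n t" "?r n t \<le> t" "0 \<le> ?r n t" for n
  proof -
    have "real (Suc n) * t - 1 \<le> real_of_int \<lfloor>real (Suc n) * t\<rfloor>" "real_of_int \<lfloor>real (Suc n) * t\<rfloor> \<le> real (Suc n) * t"
      by linarith+
    from divide_right_mono[OF this(1), of "real (Suc n)"] divide_right_mono[OF this(2), of "real (Suc n)"]
    show "t - 1 / real (Suc n) \<le> ?r n t" "?r n t \<le> t" by (simp_all add: diff_divide_distrib)
    show "0 \<le> ?r n t" using t by simp
  qed
  have "(\<lambda>n. ?r n t) \<longlonglongrightarrow> t"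
  proof (rule tendsto_sandwich)
    have "(\<lambda>n. t - 1 / real (Suc n)) \<longlonglongrightarrow> t - 0"
      by (intro tendsto_intros LIMSEQ_Suc[OF lim_1_over_n])
    then show "(\<lambda>n. t - 1 / real (Suc n)) \<longlonglongrightarrow> t" by simp
  qed (use r in auto)
  moreover have "?r n t \<in> {0..T}" for n using r[of n] t by auto
  ultimately have "(\<lambda>n. u (?r n t)) \<longlonglongrightarrow> u t"
    using u t by (auto simp: continuous_on_sequentially o_def)
  then show "(\<lambda>n. H t (u (?r n t))) \<longlonglongrightarrow> H t (u t)"
    using Hc[OF t] by (intro isCont_tendsto_compose[of _ "H t"]) (auto simp: continuous_on_eq_continuous_at)
qed

text \<open>Pulling out exp (l * t) leaves at most the integral of kern x * exp (- l x) over the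
  line, which tends to 0 as l grows by dominated convergence.\<close>

lemma kern_weighted:
  assumes b: "0 < b" and T: "0 \<le> T" and e: "0 < e"
  obtains l where "0 \<le> l"
    "\<And>t. integrable (lebesgue_on {0..T}) (\<lambda>s. kern b T (t - s) * exp (l * s))"
    "\<And>t. (LINT s|lebesgue_on {0..T}. kern b T (t - s) * exp (l * s)) \<le> e * exp (l * t)"
proof -
  note K = kern_integral(1)[OF b T]
  have m: "(\<lambda>x. kern b T x * exp (- (l * x))) \<in> borel_measurable lebesgue" for l
    by (intro measurable_completion) measurable
  have le: "\<bar>kern b T x * exp (- (l * x))\<bar> \<le> kern b T x" if "0 \<le> l" for x l
  proof (cases "0 < x")
    case True
    then show ?thesis using that by (simp add: abs_mult mult_left_le)
  qed (simp add: kern_def)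
  have "(\<lambda>n. LINT x|lebesgue. kern b T x * exp (- (real n * x))) \<longlonglongrightarrow> (LINT x|(lebesgue :: real measure). 0)"
  proof (rule integral_dominated_convergence[where w = "kern b T"])
    have "(\<lambda>n. kern b T x * exp (- (real n * x))) \<longlonglongrightarrow> 0" for x
    proof (cases "0 < x")
      case True
      then have "(\<lambda>n. exp (- x) ^ n) \<longlonglongrightarrow> 0" by (intro LIMSEQ_realpow_zero) auto
      then have "(\<lambda>n. kern b T x * exp (- x) ^ n) \<longlonglongrightarrow> kern b T x * 0" by (rule tendsto_mult[OF tendsto_const])
      then show ?thesis by (simp flip: exp_of_nat_mult)
    qed (simp add: kern_def)
    then show "AE x in lebesgue. (\<lambda>n. kern b T x * exp (- (real n * x))) \<longlonglongrightarrow> 0" by simp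
    show "AE x in lebesgue. norm (kern b T x * exp (- (real n * x))) \<le> kern b T x" for n
      using le[of "real n"] by (intro AE_I2) simp
  qed (use m K in auto)
  then have "\<forall>\<^sub>F n in sequentially. (LINT x|lebesgue. kern b T x * exp (- (real n * x))) < e"
    using e by (intro order_tendstoD(2)) auto
  then obtain n :: nat where n: "(LINT x|lebesgue. kern b T x * exp (- (real n * x))) < e"
    by (auto simp: eventually_sequentially)
  define l where "l = real n"
  have i: "integrable lebesgue (\<lambda>x. kern b T x * exp (- (l * x)))"
  proof (rule Bochner_Integration.integrable_bound[OF K m])
    show "AE x in lebesgue. norm (kern b T x * exp (- (l * x))) \<le> norm (kern b T x)"
      using le[of l] by (intro AE_I2) (simp add: l_def)
  qed
  note R = reflect_integral_le[OF i, of "{0..T}"]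
  have eq: "kern b T (t - s) * exp (l * s) = (kern b T (t - s) * exp (- (l * (t - s)))) * exp (l * t)" for t s
    by (simp add: right_diff_distrib flip: exp_add)
  show thesis
  proof
    show "0 \<le> l" by (simp add: l_def)
    fix t
    show "integrable (lebesgue_on {0..T}) (\<lambda>s. kern b T (t - s) * exp (l * s))"
      unfolding eq[of t] using R(1)[of t] by (intro integrable_mult_left) auto
    have "(LINT s|lebesgue_on {0..T}. kern b T (t - s) * exp (- (l * (t - s)))) \<le> e"
      using R(2)[of t] n by (simp add: l_def)
    then show "(LINT s|lebesgue_on {0..T}. kern b T (t - s) * exp (l * s)) \<le> e * exp (l * t)"
      unfolding eq[of t] by simp
  qed
qed

lemma rl_integral_diff:
  fixes f g :: "real \<Rightarrow> real^'m"
  assumes p: "1 < p" "1 / p < b" and t: "t \<in> {0..T}"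
    and f: "f \<in> borel_measurable (lebesgue_on {0..T})" "integrable (lebesgue_on {0..T}) (\<lambda>s. norm (f s) powr p)"
    and g: "g \<in> borel_measurable (lebesgue_on {0..T})" "integrable (lebesgue_on {0..T}) (\<lambda>s. norm (g s) powr p)"
  shows "rl_integral b f t - rl_integral b g t = rl_integral b (\<lambda>s. f s - g s) t"
proof -
  have T: "0 \<le> T" using t by simp
  show ?thesis
    unfolding rl_integral_kern[OF t] scaleR_diff_right
    using conv_integrable(1)[OF p T f, of t] conv_integrable(1)[OF p T g, of t]
    by (simp add: Bochner_Integration.integral_diff scaleR_diff_right)
qed

text \<open>The operator norm of J^b in the weighted norm, phrased with a pointwise majorant; it
  yields both the contraction and uniqueness.\<close>

lemma rl_integral_weighted_bound:
  fixes h :: "real \<Rightarrow> real^'m"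
  assumes b: "0 < b" and t: "t \<in> {0..T}"
    and i: "integrable (lebesgue_on {0..T}) (\<lambda>s. kern b T (t - s) * exp (l * s))"
    and l: "(LINT s|lebesgue_on {0..T}. kern b T (t - s) * exp (l * s)) \<le> e * exp (l * t)"
    and h: "h \<in> borel_measurable (lebesgue_on {0..T})"
    and K: "0 \<le> K" "\<And>s. s \<in> {0..T} \<Longrightarrow> norm (h s) \<le> K * exp (l * s)"
  shows "norm (rl_integral b h t) \<le> K * e / Gamma b * exp (l * t)"
proof -
  let ?M = "lebesgue_on {0..T}"
  have G: "0 < Gamma b" using b by (rule Gamma_real_pos)
  have [measurable]: "h \<in> borel_measurable ?M" by fact
  have [measurable]: "(\<lambda>s. kern b T (t - s)) \<in> borel_measurable ?M"
    by (rule borel_measurable_lebesgue_onI) measurable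
  have i': "integrable ?M (\<lambda>s. K * (kern b T (t - s) * exp (l * s)))"
    using i by auto
  have le: "norm (kern b T (t - s) *\<^sub>R h s) \<le> K * (kern b T (t - s) * exp (l * s))" if "s \<in> {0..T}" for s
    using mult_left_mono[OF K(2)[OF that] kern_nonneg[of b T "t - s"]] by (simp add: mult_ac)
  have ih: "integrable ?M (\<lambda>s. kern b T (t - s) *\<^sub>R h s)"
  proof (rule Bochner_Integration.integrable_bound[OF i'])
    show "AE s in ?M. norm (kern b T (t - s) *\<^sub>R h s) \<le> norm (K * (kern b T (t - s) * exp (l * s)))"
      using le by (intro AE_I2) (auto intro: order_trans[OF _ abs_ge_self])
  qed measurable
  have "norm (LINT s|?M. kern b T (t - s) *\<^sub>R h s) \<le> (LINT s|?M. K * (kern b T (t - s) * exp (l * s)))"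
    by (rule Bochner_Integration.integral_norm_bound_integral[OF ih i']) (use le in simp)
  also have "\<dots> \<le> K * (e * exp (l * t))"
    using l K(1) by (simp add: mult_left_mono)
  finally show ?thesis
    unfolding rl_integral_kern[OF t] using G by (simp add: field_simps)
qed

lemma powr_sum_le:
  assumes "0 \<le> (x::real)" "0 \<le> y" "0 \<le> p"
  shows "(x + y) powr p \<le> 2 powr p * (x powr p + y powr p)"
proof -
  have "(x + y) powr p \<le> (2 * max x y) powr p"
    using assms by (intro powr_mono2) auto
  also have "\<dots> = 2 powr p * max x y powr p"
    using assms by (intro powr_mult)
  also have "\<dots> \<le> 2 powr p * (x powr p + y powr p)"
    by (intro mult_left_mono) (auto simp: max_def)
  finally show ?thesis .
qed

lemma powr_integrable_dominated:
  fixes h :: "real \<Rightarrow> 'b::euclidean_space"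
  assumes p: "0 \<le> p" and g: "\<And>s. 0 \<le> g s" "integrable (lebesgue_on {0..T}) (\<lambda>s. g s powr p)"
    and h: "h \<in> borel_measurable (lebesgue_on {0..T})"
    and K: "0 \<le> K" "\<And>s. s \<in> {0..T} \<Longrightarrow> norm (h s) \<le> g s + K"
  shows "integrable (lebesgue_on {0..T}) (\<lambda>s. norm (h s) powr p)"
proof (rule Bochner_Integration.integrable_bound)
  interpret finite_measure "lebesgue_on {0..T}" by (rule finite_measure_lebesgue_on_Icc)
  show "integrable (lebesgue_on {0..T}) (\<lambda>s. 2 powr p * (g s powr p + K powr p))"
    using g by auto
  show "(\<lambda>s. norm (h s) powr p) \<in> borel_measurable (lebesgue_on {0..T})"
    using h by measurable
  have "norm (h s) powr p \<le> 2 powr p * (g s powr p + K powr p)" if "s \<in> {0..T}" for s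
    using powr_mono2[OF p norm_ge_zero K(2)[OF that]] powr_sum_le[OF g(1) K(1) p, of s] by linarith
  then show "AE s in lebesgue_on {0..T}. norm (norm (h s) powr p) \<le> norm (2 powr p * (g s powr p + K powr p))"
    by (intro AE_I2) (auto intro: order_trans[OF _ abs_ge_self])
qed

lemma nemytskii_powr_integrable:
  fixes H :: "real \<Rightarrow> 'a::euclidean_space \<Rightarrow> 'b::euclidean_space"
  assumes H: "\<And>x. (\<lambda>t. H t x) \<in> borel_measurable (lebesgue_on {0..T})"
    and Hc: "\<And>t. t \<in> {0..T} \<Longrightarrow> continuous_on UNIV (H t)"
    and gr: "\<And>t x. t \<in> {0..T} \<Longrightarrow> norm (H t x) \<le> g t + C * norm x"
    and p: "0 \<le> p" and g: "\<And>s. 0 \<le> g s" "integrable (lebesgue_on {0..T}) (\<lambda>s. g s powr p)"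
    and C: "0 \<le> C" and u: "continuous_on {0..T} u"
  shows "(\<lambda>t. H t (u t)) \<in> borel_measurable (lebesgue_on {0..T})"
    "integrable (lebesgue_on {0..T}) (\<lambda>t. norm (H t (u t)) powr p)"
proof -
  show m: "(\<lambda>t. H t (u t)) \<in> borel_measurable (lebesgue_on {0..T})"
    by (rule caratheodory_composition_measurable[OF H Hc u])
  have "bounded (u ` {0..T})"
    by (intro compact_imp_bounded compact_continuous_image u) auto
  then obtain B where "0 < B" "\<And>t. t \<in> {0..T} \<Longrightarrow> norm (u t) \<le> B"
    unfolding bounded_pos by (metis imageI)
  then have "norm (H t (u t)) \<le> g t + C * B" "0 \<le> C * B" if "t \<in> {0..T}" for t
    using order_trans[OF gr[OF that, of "u t"]] mult_left_mono[OF _ C, of "norm (u t)" B] that C by auto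
  then show "integrable (lebesgue_on {0..T}) (\<lambda>t. norm (H t (u t)) powr p)"
    by (cases "{0..T} = {}")
      (auto intro!: powr_integrable_dominated[OF p g m, of "C * B"] simp: integrable_lebesgue_on_empty)
qed

lemma half_small:
  assumes "0 < (G::real)" "0 \<le> L"
  shows "\<exists>e>0. L * e / G \<le> 1 / 2"
proof (intro exI conjI)
  \<comment> \<open>The + 1 admits L = 0.\<close>
  show "0 < G / (2 * (L + 1))" using assms by simp
  have "L * (G / (2 * (L + 1))) / G = L / (L + 1) * (1 / 2)" using assms by simp
  also have "\<dots> \<le> 1 * (1 / 2)" using assms by (intro mult_right_mono) auto
  finally show "L * (G / (2 * (L + 1))) / G \<le> 1 / 2" by simp
qed

text \<open>
  Picard iteration for \<open>w(t) = exp (- l t) u(t)\<close> instead of \<open>u\<close>: for large \<open>l\<close> it contracts on all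
  of \<open>[0,T]\<close>.
\<close>

lemma lipschitz_volterra_exists:
  fixes H :: "real \<Rightarrow> real^'m \<Rightarrow> real^'m"
  assumes T: "0 < T" and p: "1 < p" "1 / p < \<alpha>" "\<alpha> < 1"
    and H: "\<And>x. (\<lambda>t. H t x) \<in> borel_measurable (lebesgue_on {0..T})"
    and lip: "\<And>t x y. t \<in> {0..T} \<Longrightarrow> norm (H t x - H t y) \<le> L * norm (x - y)" and L: "0 \<le> L"
    and gr: "\<And>t x. t \<in> {0..T} \<Longrightarrow> norm (H t x) \<le> g t + C * norm x"
    and g: "\<And>s. 0 \<le> g s" "integrable (lebesgue_on {0..T}) (\<lambda>s. g s powr p)"
    and C: "0 \<le> C"
  shows "\<exists>u. continuous_on {0..T} u \<and> (\<forall>t\<in>{0..T}. u t = u0 + rl_integral \<alpha> (\<lambda>s. H s (u s)) t)"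
proof -
  have T0: "0 \<le> T" using T by simp
  have p0: "0 \<le> p" using p by simp
  have "0 < 1 / p" using p by simp
  then have \<alpha>: "0 < \<alpha>" "\<alpha> \<le> 1" using p by linarith+
  have G: "0 < Gamma \<alpha>" using \<alpha> by (intro Gamma_real_pos)
  have Hc: "continuous_on UNIV (H t)" if "t \<in> {0..T}" for t
    using lip[OF that] L by (intro lipschitz_on_continuous_on[OF lipschitz_onI[of _ _ L]]) (auto simp: dist_norm)
  have N: "(\<lambda>t. H t (u t)) \<in> borel_measurable (lebesgue_on {0..T})"
    "integrable (lebesgue_on {0..T}) (\<lambda>t. norm (H t (u t)) powr p)" if "continuous_on {0..T} u" for u
    using nemytskii_powr_integrable[OF H Hc gr p0 g C that] by blast+
  obtain e where e: "0 < e" "L * e / Gamma \<alpha> \<le> 1 / 2" using half_small[OF G L] by blast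
  obtain l where l: "0 \<le> l"
    "\<And>t. integrable (lebesgue_on {0..T}) (\<lambda>s. kern \<alpha> T (t - s) * exp (l * s))"
    "\<And>t. (LINT s|lebesgue_on {0..T}. kern \<alpha> T (t - s) * exp (l * s)) \<le> e * exp (l * t)"
    by (rule kern_weighted[OF \<alpha>(1) T0 e(1)]) blast
  \<comment> \<open>\<open>E\<close> returns from the weighted unknown w to u, and \<open>S\<close>
    is the Volterra operator conjugated by this change, so that the plain sup distance of w is the
    weighted one of u.\<close>
  define E where "E = (\<lambda>(w :: real \<Rightarrow>\<^sub>C (real^'m)) s. exp (l * s) *\<^sub>R w s)"
  define S where "S = (\<lambda>w t. exp (- (l * t)) *\<^sub>R (u0 + rl_integral \<alpha> (\<lambda>s. H s (E w s)) t))"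
  have Ec: "continuous_on {0..T} (E w)" for w
    unfolding E_def by (intro continuous_intros continuous_on_apply_bcontfun)
  have Jc: "continuous_on {0..T} (rl_integral \<alpha> (\<lambda>s. H s (E w s)))" for w
    by (rule rl_integral_continuous[OF p(1,2) \<alpha>(2) T0 N[OF Ec]])
  have "continuous_on (cbox 0 T) (S w)" for w
    unfolding S_def cbox_interval by (intro continuous_on_scaleR continuous_on_add Jc continuous_intros)
  \<comment> \<open>Composing with \<open>clamp\<close> extends \<open>S w\<close> by its boundary
    values to a bounded continuous function on the line, which makes the operator a self-map of a
    complete metric type.\<close>
  then have "\<exists>v :: real \<Rightarrow>\<^sub>C (real^'m). (\<forall>x. v x = S w (clamp 0 T x))" for w
    by (rule continuous_on_cbox_bcontfunE) blast
  then obtain F :: "(real \<Rightarrow>\<^sub>C (real^'m)) \<Rightarrow> (real \<Rightarrow>\<^sub>C (real^'m))" where F: "\<And>w x. F w x = S w (clamp 0 T x)"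
    by metis
  have cl: "clamp 0 T x \<in> {0..T}" for x
    using clamp_in_interval[of 0 T x] T by simp
  have cl': "clamp 0 T x = x" if "x \<in> {0..T}" for x
    using that by (simp add: clamp_cancel_cbox)
  have "dist (F v) (F w) \<le> (1 / 2) * dist v w" for v w
  proof (rule dist_bound)
    fix x
    define t where "t = clamp 0 T x"
    have t: "t \<in> {0..T}" unfolding t_def by (rule cl)
    have d: "norm (H s (E v s) - H s (E w s)) \<le> L * dist v w * exp (l * s)" if "s \<in> {0..T}" for s
    proof -
      have "norm (H s (E v s) - H s (E w s)) \<le> L * norm (E v s - E w s)"
        by (rule lip[OF that])
      also have "E v s - E w s = exp (l * s) *\<^sub>R (v s - w s)"
        by (simp add: E_def scaleR_diff_right)
      also have "L * norm (exp (l * s) *\<^sub>R (v s - w s)) = L * exp (l * s) * dist (v s) (w s)"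
        by (simp add: dist_norm)
      also have "\<dots> \<le> L * exp (l * s) * dist v w"
        using L by (intro mult_left_mono dist_bounded) auto
      finally show ?thesis by (simp add: mult_ac)
    qed
    have m: "(\<lambda>s. H s (E v s) - H s (E w s)) \<in> borel_measurable (lebesgue_on {0..T})"
      using N(1)[OF Ec[of v]] N(1)[OF Ec[of w]] by measurable
    have "norm (rl_integral \<alpha> (\<lambda>s. H s (E v s)) t - rl_integral \<alpha> (\<lambda>s. H s (E w s)) t)
       = norm (rl_integral \<alpha> (\<lambda>s. H s (E v s) - H s (E w s)) t)"
      by (subst rl_integral_diff[OF p(1,2) t N[OF Ec] N[OF Ec]]) simp
    also have "\<dots> \<le> (L * dist v w) * e / Gamma \<alpha> * exp (l * t)"
      using L by (intro rl_integral_weighted_bound[OF \<alpha>(1) t l(2) l(3) m] d) auto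
    also have "\<dots> = (L * e / Gamma \<alpha>) * (dist v w * exp (l * t))"
      by (simp add: mult_ac)
    also have "\<dots> \<le> 1 / 2 * (dist v w * exp (l * t))"
      using e(2) by (intro mult_right_mono) auto
    finally have *: "norm (rl_integral \<alpha> (\<lambda>s. H s (E v s)) t - rl_integral \<alpha> (\<lambda>s. H s (E w s)) t) \<le> 1 / 2 * (dist v w * exp (l * t))" .
    have "dist (F v x) (F w x) = exp (- (l * t)) * norm (rl_integral \<alpha> (\<lambda>s. H s (E v s)) t - rl_integral \<alpha> (\<lambda>s. H s (E w s)) t)"
      unfolding F t_def[symmetric] S_def dist_norm scaleR_diff_right[symmetric] by simp
    also have "\<dots> \<le> exp (- (l * t)) * (1 / 2 * (dist v w * exp (l * t)))"
      by (intro mult_left_mono *) auto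
    also have "\<dots> = 1 / 2 * dist v w"
      by (simp add: exp_minus)
    finally show "dist (F v x) (F w x) \<le> 1 / 2 * dist v w" .
  qed
  then have "\<exists>!w. F w = w" by (intro banach_fix_type[of "1/2"]) auto
  then obtain w where w: "F w = w" by blast
  show ?thesis
  proof (intro exI conjI ballI)
    show "continuous_on {0..T} (E w)" by (rule Ec)
    fix t assume t: "t \<in> {0..T}"
    have "w t = S w t" using F[of w t] w cl'[OF t] by simp
    then show "E w t = u0 + rl_integral \<alpha> (\<lambda>s. H s (E w s)) t"
      by (simp add: E_def S_def exp_minus)
  qed
qed

section \<open>A priori bound and uniqueness by absorption at a maximum\<close>

lemma weighted_sup:
  fixes u :: "real \<Rightarrow> 'b::real_normed_vector"
  assumes "0 \<le> T" "continuous_on {0..T} u"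
  obtains K t where "t \<in> {0..T}" "0 \<le> K" "norm (u t) = K * exp (l * t)"
    "\<And>s. s \<in> {0..T} \<Longrightarrow> norm (u s) \<le> K * exp (l * s)"
proof -
  have "continuous_on {0..T} (\<lambda>t. exp (- (l * t)) * norm (u t))"
    by (intro continuous_intros assms)
  \<comment> \<open>The maximiser is kept: there the weighted bound is an equality, which lets half
    of it be absorbed in later estimates.\<close>
  then obtain t where t: "t \<in> {0..T}" "\<And>s. s \<in> {0..T} \<Longrightarrow> exp (- (l * s)) * norm (u s) \<le> exp (- (l * t)) * norm (u t)"
    using continuous_attains_sup[of "{0..T}" "\<lambda>t. exp (- (l * t)) * norm (u t)"] assms(1) by auto
  show thesis
  proof
    show "norm (u t) = (exp (- (l * t)) * norm (u t)) * exp (l * t)"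
      by (simp add: exp_minus)
    show "norm (u s) \<le> (exp (- (l * t)) * norm (u t)) * exp (l * s)" if "s \<in> {0..T}" for s
      using mult_right_mono[OF t(2)[OF that], of "exp (l * s)"] by (simp add: exp_minus field_simps)
  qed (use t in auto)
qed

text \<open>At the maximiser m of the weighted norm, the linear part of the growth contributes at
  most half of K * exp (l * m), which moves to the left side. R depends on \<open>g\<close>,
  \<open>C\<close> and \<open>u0\<close> but not on \<open>h\<close>, so it holds for the projected
  equation as well.\<close>

lemma volterra_a_priori_bound:
  assumes T: "0 < T" and p: "1 < p" "1 / p < \<alpha>" "\<alpha> < 1"
    and g: "\<And>s. 0 \<le> g s" "g \<in> borel_measurable (lebesgue_on {0..T})" "integrable (lebesgue_on {0..T}) (\<lambda>s. g s powr p)"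
    and C: "0 \<le> C"
  shows "\<exists>R. \<forall>(u :: real \<Rightarrow> real^'m) h. continuous_on {0..T} u \<longrightarrow>
     h \<in> borel_measurable (lebesgue_on {0..T}) \<longrightarrow>
     (\<forall>s\<in>{0..T}. norm (h s) \<le> g s + C * norm (u s)) \<longrightarrow>
     (\<forall>t\<in>{0..T}. u t = u0 + rl_integral \<alpha> h t) \<longrightarrow> (\<forall>t\<in>{0..T}. norm (u t) \<le> R)"
proof -
  let ?M = "lebesgue_on {0..T}"
  have T0: "0 \<le> T" using T by simp
  have "0 < 1 / p" using p by simp
  then have \<alpha>: "0 < \<alpha>" "\<alpha> \<le> 1" using p by linarith+
  have G: "0 < Gamma \<alpha>" using \<alpha> by (intro Gamma_real_pos)
  obtain e where e: "0 < e" "C * e / Gamma \<alpha> \<le> 1 / 2" using half_small[OF G C] by blast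
  obtain l where l: "0 \<le> l"
    "\<And>t. integrable ?M (\<lambda>s. kern \<alpha> T (t - s) * exp (l * s))"
    "\<And>t. (LINT s|?M. kern \<alpha> T (t - s) * exp (l * s)) \<le> e * exp (l * t)"
    by (rule kern_weighted[OF \<alpha>(1) T0 e(1)]) blast
  have gp: "integrable ?M (\<lambda>s. norm (g s) powr p)" using g by simp
  \<comment> \<open>Young's inequality with weight 1: only a bound uniform in t is wanted here, not
    a small one.\<close>
  have "\<exists>A. \<forall>t. (LINT s|?M. kern \<alpha> T (t - s) * norm (g s)) \<le> A"
    using conv_integrable(2)[OF p(1,2) T0 g(2) gp zero_less_one refl] by blast
  then obtain A where A: "\<And>t. (LINT s|?M. kern \<alpha> T (t - s) * g s) \<le> A" using g(1) by auto
  have ig: "integrable ?M (\<lambda>s. kern \<alpha> T (t - s) * g s)" for t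
    using conv_integrable(1)[OF p(1,2) T0 g(2) gp, of t] by simp
  define Q where "Q = norm u0 + A / Gamma \<alpha>"
  have "norm (u t) \<le> 2 * Q * exp (l * T)"
    if u: "continuous_on {0..T} u" and h: "h \<in> borel_measurable ?M"
      and hb: "\<forall>s\<in>{0..T}. norm (h s) \<le> g s + C * norm (u s)"
      and eq: "\<forall>t\<in>{0..T}. u t = u0 + rl_integral \<alpha> h t" and t: "t \<in> {0..T}"
    for u h :: "real \<Rightarrow> real^'m" and t
  proof -
    obtain K m where K: "m \<in> {0..T}" "0 \<le> K" "norm (u m) = K * exp (l * m)"
      "\<And>s. s \<in> {0..T} \<Longrightarrow> norm (u s) \<le> K * exp (l * s)"
      by (rule weighted_sup[OF T0 u]) blast
    have "norm (LINT s|?M. kern \<alpha> T (m - s) *\<^sub>R h s)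
      \<le> (LINT s|?M. kern \<alpha> T (m - s) * g s + C * K * (kern \<alpha> T (m - s) * exp (l * s)))"
    proof (rule Bochner_Integration.integral_norm_bound_integral)
      have [measurable]: "h \<in> borel_measurable ?M" by fact
      have [measurable]: "(\<lambda>s. kern \<alpha> T (m - s)) \<in> borel_measurable ?M"
        by (rule borel_measurable_lebesgue_onI) measurable
      show i: "integrable ?M (\<lambda>s. kern \<alpha> T (m - s) * g s + C * K * (kern \<alpha> T (m - s) * exp (l * s)))"
        using ig l(2) by auto
      have "norm (kern \<alpha> T (m - s) *\<^sub>R h s) \<le> kern \<alpha> T (m - s) * g s + C * K * (kern \<alpha> T (m - s) * exp (l * s))"
        if s: "s \<in> {0..T}" for s
      proof -
        have "norm (h s) \<le> g s + C * (K * exp (l * s))"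
          using order_trans[OF bspec[OF hb s]] mult_left_mono[OF K(4)[OF s] C] by simp
        from mult_left_mono[OF this kern_nonneg[of \<alpha> T "m - s"]] show ?thesis
          by (simp add: algebra_simps)
      qed
      note le = this
      then show "norm (kern \<alpha> T (m - s) *\<^sub>R h s) \<le> kern \<alpha> T (m - s) * g s + C * K * (kern \<alpha> T (m - s) * exp (l * s))"
        if "s \<in> space ?M" for s using that by simp
      show "integrable ?M (\<lambda>s. kern \<alpha> T (m - s) *\<^sub>R h s)"
      proof (rule Bochner_Integration.integrable_bound[OF i])
        show "AE s in ?M. norm (kern \<alpha> T (m - s) *\<^sub>R h s) \<le> norm (kern \<alpha> T (m - s) * g s + C * K * (kern \<alpha> T (m - s) * exp (l * s)))"
          using le by (intro AE_I2) (auto intro: order_trans[OF _ abs_ge_self])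
      qed measurable
    qed
    also have "\<dots> = (LINT s|?M. kern \<alpha> T (m - s) * g s) + C * K * (LINT s|?M. kern \<alpha> T (m - s) * exp (l * s))"
      using ig l(2) by simp
    also have "\<dots> \<le> A + C * K * (e * exp (l * m))"
      using A l(3) C K(2) by (intro add_mono mult_left_mono) auto
    finally have "norm (rl_integral \<alpha> h m) \<le> (A + C * K * (e * exp (l * m))) / Gamma \<alpha>"
      unfolding rl_integral_kern[OF K(1)] using G by (simp add: divide_right_mono)
    also have "\<dots> = A / Gamma \<alpha> + (C * e / Gamma \<alpha>) * (K * exp (l * m))"
      by (simp add: add_divide_distrib mult_ac)
    also have "\<dots> \<le> A / Gamma \<alpha> + 1 / 2 * (K * exp (l * m))"
      using e(2) K(2) by (intro add_left_mono mult_right_mono) auto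
    finally have "norm (u m) \<le> Q + 1 / 2 * (K * exp (l * m))"
      using eq K(1) norm_triangle_ineq[of u0 "rl_integral \<alpha> h m"] unfolding Q_def by simp
    \<comment> \<open>Absorption of the half; as exp (l * m) is at least 1, it also bounds
      K.\<close>
    then have "K * exp (l * m) \<le> 2 * Q" using K(3) by simp
    moreover have "K * 1 \<le> K * exp (l * m)" using K(1,2) l(1) by (intro mult_left_mono) auto
    ultimately have KQ: "K \<le> 2 * Q" by simp
    have "norm (u t) \<le> K * exp (l * t)" by (rule K(4)[OF t])
    also have "\<dots> \<le> 2 * Q * exp (l * T)"
      using KQ K(2) t l(1) by (intro mult_mono) (auto intro: mult_left_mono)
    finally show ?thesis .
  qed
  then show ?thesis by blast
qed

text \<open>At the maximiser of the weighted difference, K * exp (l * m) is at most half of itself.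
  The Lipschitz estimate is required only along the two solutions, so one valid on a ball containing
  both will do.\<close>

lemma volterra_unique:
  fixes u v :: "real \<Rightarrow> real^'m"
  assumes T: "0 < T" and p: "1 < p" "1 / p < \<alpha>" "\<alpha> < 1"
    and u: "continuous_on {0..T} u" "\<And>t. t \<in> {0..T} \<Longrightarrow> u t = u0 + rl_integral \<alpha> h t"
      "h \<in> borel_measurable (lebesgue_on {0..T})" "integrable (lebesgue_on {0..T}) (\<lambda>s. norm (h s) powr p)"
    and v: "continuous_on {0..T} v" "\<And>t. t \<in> {0..T} \<Longrightarrow> v t = u0 + rl_integral \<alpha> k t"
      "k \<in> borel_measurable (lebesgue_on {0..T})" "integrable (lebesgue_on {0..T}) (\<lambda>s. norm (k s) powr p)"
    and lip: "\<And>s. s \<in> {0..T} \<Longrightarrow> norm (h s - k s) \<le> L * norm (u s - v s)" and L: "0 \<le> L"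
    and t: "t \<in> {0..T}"
  shows "u t = v t"
proof -
  let ?M = "lebesgue_on {0..T}"
  have T0: "0 \<le> T" using T by simp
  have "0 < 1 / p" using p by simp
  then have \<alpha>: "0 < \<alpha>" using p by linarith
  have G: "0 < Gamma \<alpha>" using \<alpha> by (intro Gamma_real_pos)
  obtain e where e: "0 < e" "L * e / Gamma \<alpha> \<le> 1 / 2" using half_small[OF G L] by blast
  obtain l where l: "0 \<le> l"
    "\<And>t. integrable ?M (\<lambda>s. kern \<alpha> T (t - s) * exp (l * s))"
    "\<And>t. (LINT s|?M. kern \<alpha> T (t - s) * exp (l * s)) \<le> e * exp (l * t)"
    by (rule kern_weighted[OF \<alpha>(1) T0 e(1)]) blast
  have d: "continuous_on {0..T} (\<lambda>s. u s - v s)" using u(1) v(1) by (intro continuous_intros)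
  obtain K m where K: "m \<in> {0..T}" "0 \<le> K" "norm (u m - v m) = K * exp (l * m)"
    "\<And>s. s \<in> {0..T} \<Longrightarrow> norm (u s - v s) \<le> K * exp (l * s)"
    by (rule weighted_sup[OF T0 d]) blast
  have "norm (u m - v m) = norm (rl_integral \<alpha> (\<lambda>s. h s - k s) m)"
    using rl_integral_diff[OF p(1,2) K(1) u(3,4) v(3,4)] u(2)[OF K(1)] v(2)[OF K(1)] by simp
  also have "\<dots> \<le> L * K * e / Gamma \<alpha> * exp (l * m)"
  proof (rule rl_integral_weighted_bound[OF \<alpha> K(1) l(2) l(3)])
    show "(\<lambda>s. h s - k s) \<in> borel_measurable ?M" using u(3) v(3) by measurable
    show "norm (h s - k s) \<le> L * K * exp (l * s)" if "s \<in> {0..T}" for s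
      using order_trans[OF lip[OF that]] mult_left_mono[OF K(4)[OF that] L] by (simp add: mult_ac)
  qed (use L K in auto)
  also have "\<dots> = (L * e / Gamma \<alpha>) * (K * exp (l * m))" by (simp add: mult_ac)
  also have "\<dots> \<le> 1 / 2 * (K * exp (l * m))" using e(2) K(2) by (intro mult_right_mono) auto
  finally have "K * exp (l * m) \<le> 0" using K(3) by simp
  then have "K = 0" using K(2) by (simp add: mult_le_0_iff)
  then show ?thesis using K(4)[OF t] by simp
qed

section \<open>Lipschitz constants on balls\<close>

text \<open>Carries the hypotheses on N to the Euclidean norm. The upper bound makes N continuous;
  its minimum on the unit sphere is the lower constant.\<close>

lemma is_norm_equivalent:
  fixes N :: "'a::euclidean_space \<Rightarrow> real"
  assumes "is_norm N"
  obtains a b where "0 < a" "0 < b" "\<And>x. a * norm x \<le> N x" "\<And>x. N x \<le> b * norm x"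
proof -
  have N: "\<And>x. 0 \<le> N x" "\<And>x. N x = 0 \<longleftrightarrow> x = 0" "\<And>c x. N (c *\<^sub>R x) = \<bar>c\<bar> * N x" "\<And>x y. N (x + y) \<le> N x + N y"
    using assms unfolding is_norm_def by auto
  define b where "b = (\<Sum>i\<in>Basis. N i) + 1"
  have b: "0 < b" unfolding b_def using N(1) by (simp add: add_nonneg_pos sum_nonneg)
  have sumN: "N (\<Sum>i\<in>A. f i) \<le> (\<Sum>i\<in>A. N (f i))" if "finite A" for A and f :: "'a \<Rightarrow> 'a"
    using that
  proof induction
    case empty
    then show ?case using N(2)[of 0] by simp
  next
    case (insert i A)
    then show ?case using N(4)[of "f i" "sum f A"] by simp
  qed
  have le: "N x \<le> b * norm x" for x
  proof -
    have "N x = N (\<Sum>i\<in>Basis. (x \<bullet> i) *\<^sub>R i)" by (simp add: euclidean_representation)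
    also have "\<dots> \<le> (\<Sum>i\<in>Basis. N ((x \<bullet> i) *\<^sub>R i))" by (rule sumN) simp
    also have "\<dots> \<le> (\<Sum>i\<in>Basis. norm x * N i)"
      unfolding N(3) by (intro sum_mono mult_right_mono N(1) Basis_le_norm)
    also have "\<dots> = norm x * (\<Sum>i\<in>Basis. N i)" by (rule sum_distrib_left[symmetric])
    also have "\<dots> \<le> b * norm x" by (simp add: b_def algebra_simps)
    finally show ?thesis .
  qed
  have "continuous_on (sphere 0 1) N"
  proof (rule lipschitz_on_continuous_on[OF lipschitz_onI])
    show "dist (N x) (N y) \<le> b * dist x y" for x y
      using N(4)[of "x - y" y] N(4)[of "y - x" x] le[of "x - y"] le[of "y - x"]
      by (simp add: dist_norm norm_minus_commute abs_le_iff)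
  qed (use b in simp)
  moreover have "sphere (0::'a) 1 \<noteq> {}" by simp
  ultimately obtain z where z: "z \<in> sphere 0 1" "\<And>x. x \<in> sphere 0 1 \<Longrightarrow> N z \<le> N x"
    using continuous_attains_inf[OF compact_sphere] by metis
  show thesis
  proof
    show "0 < N z" using z(1) N(1)[of z] N(2)[of z] by (auto simp: less_le)
    show "N z * norm x \<le> N x" for x
    proof (cases "x = 0")
      case False
      then have "N z \<le> N ((1 / norm x) *\<^sub>R x)" by (intro z(2)) simp
      then show ?thesis unfolding N(3) using False by (simp add: field_simps)
    qed (use N in simp)
  qed (rule b le)+
qed

text \<open>The gain is the order of quantifiers: one null set serves all x and y. Countably many
  pairs from a dense set produce a single null set, and continuity of \<open>G t\<close> covers the
  remaining pairs.\<close>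

lemma locally_lipschitz_ae_ball:
  fixes G :: "real \<Rightarrow> real^'m \<Rightarrow> real^'m"
  assumes N: "is_norm N" and lip: "locally_lipschitz_ae N T G"
    and Gc: "AE t in lebesgue_on {0..T}. continuous_on UNIV (G t)"
  shows "\<exists>r>0. \<exists>L\<ge>0. AE t in lebesgue_on {0..T}. \<forall>x\<in>ball x0 r. \<forall>y\<in>ball x0 r. norm (G t x - G t y) \<le> L * norm (x - y)"
proof -
  obtain a b where ab: "0 < a" "0 < b" "\<And>x. a * norm x \<le> N x" "\<And>x. N x \<le> b * norm x"
    by (rule is_norm_equivalent[OF N]) blast
  obtain r L where r: "0 < r" and L: "0 \<le> L" and rL: "\<And>x y. N (x - x0) < r \<Longrightarrow> N (y - x0) < r \<Longrightarrow>
      AE t in lebesgue_on {0..T}. N (G t x - G t y) \<le> L * N (x - y)"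
    using lip[unfolded locally_lipschitz_ae_def, rule_format, of x0] by blast
  \<comment> \<open>The Euclidean ball of radius r / b lies in the N-ball of radius r; L * b / a
    accounts for changing the norm on both sides of the estimate.\<close>
  define \<rho> where "\<rho> = r / b"
  define K where "K = L * b / a"
  have \<rho>: "0 < \<rho>" using r ab by (simp add: \<rho>_def)
  have K: "0 \<le> K" using L ab by (simp add: K_def)
  have pt: "AE t in lebesgue_on {0..T}. norm (G t x - G t y) \<le> K * norm (x - y)"
    if "x \<in> ball x0 \<rho>" "y \<in> ball x0 \<rho>" for x y
  proof -
    have "N (z - x0) < r" if "z \<in> ball x0 \<rho>" for z
    proof -
      have "N (z - x0) \<le> b * norm (z - x0)" by (rule ab)
      also have "\<dots> < b * \<rho>" using that ab by (simp add: dist_norm norm_minus_commute)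
      finally show ?thesis using ab by (simp add: \<rho>_def)
    qed
    from rL[OF this[OF that(1)] this[OF that(2)]] show ?thesis
    proof eventually_elim
      case (elim t)
      have "a * norm (G t x - G t y) \<le> L * (b * norm (x - y))"
        using ab(3)[of "G t x - G t y"] elim mult_left_mono[OF ab(4)[of "x - y"] L] by linarith
      then show ?case using ab by (simp add: K_def field_simps)
    qed
  qed
  obtain D :: "(real^'m) set" where D: "countable D" "\<And>X. open X \<Longrightarrow> X \<noteq> {} \<Longrightarrow> \<exists>d\<in>D. d \<in> X"
    using countable_dense_exists by blast
  define D' where "D' = D \<inter> ball x0 \<rho>"
  have "countable D'" using D(1) by (simp add: D'_def)
  moreover have "\<forall>x\<in>D'. \<forall>y\<in>D'. AE t in lebesgue_on {0..T}. norm (G t x - G t y) \<le> K * norm (x - y)"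
    using pt by (auto simp: D'_def)
  ultimately have "AE t in lebesgue_on {0..T}. \<forall>x\<in>D'. \<forall>y\<in>D'. norm (G t x - G t y) \<le> K * norm (x - y)"
    by (simp add: AE_ball_countable)
  with Gc have "AE t in lebesgue_on {0..T}. \<forall>x\<in>ball x0 \<rho>. \<forall>y\<in>ball x0 \<rho>. norm (G t x - G t y) \<le> K * norm (x - y)"
  proof eventually_elim
    case (elim t)
    show ?case
    proof (intro ballI, rule ccontr)
      fix x y assume xy: "x \<in> ball x0 \<rho>" "y \<in> ball x0 \<rho>" and n: "\<not> norm (G t x - G t y) \<le> K * norm (x - y)"
      \<comment> \<open>A violation would persist on an open set, hence occur on the countable dense set.\<close>
      define U where "U = {z. K * norm (fst z - snd z) < norm (G t (fst z) - G t (snd z))}"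
      have "open U"
        unfolding U_def
        by (intro open_Collect_less continuous_intros continuous_on_compose2[OF elim(1)]) auto
      then have "open (U \<inter> ball x0 \<rho> \<times> ball x0 \<rho>)" by (intro open_Int open_Times) auto
      moreover have "(x, y) \<in> U \<inter> ball x0 \<rho> \<times> ball x0 \<rho>" using xy n by (simp add: U_def)
      ultimately obtain A B where AB: "open A" "open B" "(x, y) \<in> A \<times> B" "A \<times> B \<subseteq> U \<inter> ball x0 \<rho> \<times> ball x0 \<rho>"
        by (rule open_prod_elim) blast
      obtain d e where de: "d \<in> D" "d \<in> A" "e \<in> D" "e \<in> B"
        using D(2)[OF AB(1)] D(2)[OF AB(2)] AB(3) by auto
      then have "(d, e) \<in> U \<inter> ball x0 \<rho> \<times> ball x0 \<rho>" using AB(4) by blast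
      then show False using elim(2) de by (force simp: D'_def U_def)
    qed
  qed
  then show ?thesis using \<rho> K by blast
qed

text \<open>Along the segment from x to y, estimates on finitely many closed sets chain without
  increasing the constant. The half radii make the sets closed while keeping them inside the balls
  where the estimate holds.\<close>

lemma locally_lipschitz_imp_lipschitz_segment:
  fixes f :: "'a::euclidean_space \<Rightarrow> 'b::euclidean_space"
  assumes "finite I" and L: "0 \<le> L" and S: "convex S" "S \<subseteq> (\<Union>i\<in>I. ball i (r i / 2))"
    and lip: "\<And>i x y. i \<in> I \<Longrightarrow> x \<in> ball i (r i) \<Longrightarrow> y \<in> ball i (r i) \<Longrightarrow> norm (f x - f y) \<le> L * norm (x - y)"
    and r: "\<And>i. i \<in> I \<Longrightarrow> 0 < r i"
    and xy: "x \<in> S" "y \<in> S"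
  shows "norm (f x - f y) \<le> L * norm (x - y)"
proof -
  define g where "g = (\<lambda>\<tau>. x + \<tau> *\<^sub>R (y - x))"
  define U where "U = (\<lambda>i. {\<tau>. g \<tau> \<in> cball i (r i / 2)})"
  have "(L * norm (y - x))-lipschitz_on {0..1} (f \<circ> g)"
  proof (rule lipschitz_on_closed_Union[where U = U and I = I])
    fix i assume i: "i \<in> I"
    show "closed (U i)"
      unfolding U_def g_def mem_cball by (intro closed_Collect_le continuous_intros)
    show "(L * norm (y - x))-lipschitz_on (U i) (f \<circ> g)"
    proof (rule lipschitz_onI)
      fix \<sigma> \<tau> assume "\<sigma> \<in> U i" "\<tau> \<in> U i"
      then have "g \<sigma> \<in> ball i (r i)" "g \<tau> \<in> ball i (r i)"
        using r[OF i] by (auto simp: U_def)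
      then have "norm (f (g \<sigma>) - f (g \<tau>)) \<le> L * norm (g \<sigma> - g \<tau>)" by (rule lip[OF i])
      also have "g \<sigma> - g \<tau> = (\<sigma> - \<tau>) *\<^sub>R (y - x)" by (simp add: g_def algebra_simps)
      finally show "dist ((f \<circ> g) \<sigma>) ((f \<circ> g) \<tau>) \<le> L * norm (y - x) * dist \<sigma> \<tau>"
        by (simp add: dist_norm mult_ac)
    qed (use L in simp)
  next
    have "g \<tau> \<in> S" if "\<tau> \<in> {0..1}" for \<tau>
      using convexD_alt[OF S(1) xy, of \<tau>] that by (simp add: g_def algebra_simps)
    then show "{0..1} \<subseteq> (\<Union>i\<in>I. U i)"
      using S(2) by (force simp: U_def)
  qed (use \<open>finite I\<close> L in auto)
  from lipschitz_onD[OF this, of 0 1] show ?thesis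
    by (simp add: g_def dist_norm norm_minus_commute)
qed

lemma locally_lipschitz_ae_cball:
  fixes G :: "real \<Rightarrow> real^'m \<Rightarrow> real^'m"
  assumes N: "is_norm N" and lip: "locally_lipschitz_ae N T G"
    and Gc: "AE t in lebesgue_on {0..T}. continuous_on UNIV (G t)"
  shows "\<exists>L\<ge>0. AE t in lebesgue_on {0..T}. \<forall>x\<in>cball 0 R. \<forall>y\<in>cball 0 R. norm (G t x - G t y) \<le> L * norm (x - y)"
proof -
  let ?P = "\<lambda>z r L. AE t in lebesgue_on {0..T}. \<forall>x\<in>ball z r. \<forall>y\<in>ball z r. norm (G t x - G t y) \<le> L * norm (x - y)"
  have "\<forall>z. \<exists>q. 0 < fst q \<and> 0 \<le> snd q \<and> ?P z (fst q) (snd q)"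
  proof
    fix z
    obtain r L where "0 < r" "0 \<le> L" "?P z r L"
      using locally_lipschitz_ae_ball[OF N lip Gc, of z] by blast
    then show "\<exists>q. 0 < fst q \<and> 0 \<le> snd q \<and> ?P z (fst q) (snd q)"
      by (intro exI[of _ "(r, L)"]) simp
  qed
  from choice[OF this] obtain q where q: "\<forall>z. 0 < fst (q z) \<and> 0 \<le> snd (q z) \<and> ?P z (fst (q z)) (snd (q z))"
    by blast
  define r where "r = (\<lambda>z. fst (q z))"
  define L where "L = (\<lambda>z. snd (q z))"
  have rL: "0 < r z" "0 \<le> L z" "?P z (r z) (L z)" for z
    using q unfolding r_def L_def by blast+
  have cover: "cball 0 R \<subseteq> (\<Union>z\<in>UNIV. ball z (r z / 2))"
  proof
    show "x \<in> (\<Union>z\<in>UNIV. ball z (r z / 2))" for x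
      using rL(1)[of x] by (intro UN_I[of x]) auto
  qed
  obtain I where I: "finite I" "cball 0 R \<subseteq> (\<Union>z\<in>I. ball z (r z / 2))"
    by (rule compactE_image[OF compact_cball _ cover]) blast+
  \<comment> \<open>The sum serves as a common upper bound of the finitely many constants.\<close>
  define K where "K = (\<Sum>z\<in>I. L z)"
  have K: "0 \<le> K" unfolding K_def by (intro sum_nonneg rL)
  have LK: "L z \<le> K" if "z \<in> I" for z
    unfolding K_def using that I(1) rL(2) by (intro member_le_sum) auto
  have "AE t in lebesgue_on {0..T}. \<forall>z\<in>I. \<forall>x\<in>ball z (r z). \<forall>y\<in>ball z (r z). norm (G t x - G t y) \<le> L z * norm (x - y)"
    by (rule AE_finite_allI[OF I(1)]) (rule rL(3))
  then have "AE t in lebesgue_on {0..T}. \<forall>x\<in>cball 0 R. \<forall>y\<in>cball 0 R. norm (G t x - G t y) \<le> K * norm (x - y)"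
  proof eventually_elim
    case (elim t)
    have le: "norm (G t x - G t y) \<le> K * norm (x - y)" if "z \<in> I" "x \<in> ball z (r z)" "y \<in> ball z (r z)" for x y z
      using bspec[OF bspec[OF bspec[OF elim that(1)] that(2)] that(3)] mult_right_mono[OF LK[OF that(1)] norm_ge_zero[of "x - y"]]
      by linarith
    show ?case
      by (intro ballI locally_lipschitz_imp_lipschitz_segment[OF I(1) K convex_cball I(2) le rL(1)])
  qed
  then show ?thesis using K by blast
qed

section \<open>Reduction of the theorem to the Volterra lemmas\<close>

lemma rl_integral_cong:
  assumes "\<And>s. s \<in> {0..T} \<Longrightarrow> f s = h s" "t \<in> {0..T}"
  shows "rl_integral b f t = rl_integral b h t"
  unfolding rl_integral_kern[OF assms(2)]
  using assms(1) by (intro arg_cong[where f = "scaleR (1 / Gamma b)"] Bochner_Integration.integral_cong) auto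

text \<open>\<open>g\<close> is the majorant used for the Euclidean norm: nonnegative, divided by a
  for the change of norm, and 0 at the endpoints, since \<open>in_Lp\<close> speaks only about the
  open interval.\<close>

lemma in_Lp_dominating:
  assumes "in_Lp p T \<gamma>" "0 < a"
  defines "g \<equiv> \<lambda>s. (if s \<in> {0<..<T} then \<bar>\<gamma> s\<bar> / a else 0)"
  shows "g \<in> borel_measurable (lebesgue_on {0..T})" "integrable (lebesgue_on {0..T}) (\<lambda>s. g s powr p)"
proof -
  have \<gamma>: "\<gamma> \<in> borel_measurable (lebesgue_on {0<..<T})" "integrable (lebesgue_on {0<..<T}) (\<lambda>t. \<bar>\<gamma> t\<bar> powr p)"
    using assms(1) unfolding in_Lp_def by auto
  have "(\<lambda>s. \<bar>\<gamma> s\<bar> / a) \<in> borel_measurable (lebesgue_on {0<..<T})"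
    using \<gamma>(1) by measurable
  then have "g \<in> borel_measurable lebesgue"
    unfolding g_def by (rule borel_measurable_if_I) simp
  then show "g \<in> borel_measurable (lebesgue_on {0..T})"
    by (rule measurable_restrict_space1)
  have "integrable (lebesgue_on {0<..<T}) (\<lambda>s. g s powr p) \<longleftrightarrow> integrable (lebesgue_on {0<..<T}) (\<lambda>s. \<bar>\<gamma> s\<bar> powr p / a powr p)"
    using assms(2) by (intro Bochner_Integration.integrable_cong) (auto simp: g_def powr_divide)
  then show "integrable (lebesgue_on {0..T}) (\<lambda>s. g s powr p)"
    using \<gamma>(2) unfolding lebesgue_on_Ioo_Icc by auto
qed

theorem theorem17:
  fixes T p \<alpha> C :: real
    and N :: "real^'m \<Rightarrow> real"
    and G :: "real \<Rightarrow> real^'m \<Rightarrow> real^'m"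
    and \<gamma> :: "real \<Rightarrow> real"
    and u0 :: "real^'m"
  assumes "T > 0"
    and "p > 1"
    and "1 / p < \<alpha>" and "\<alpha> < 1"
    and "is_norm N"
    and "caratheodory T G"
    and "in_Lp p T \<gamma>"
    and "AE t in lebesgue_on {0..T}. \<forall>x. N (G t x) \<le> \<gamma> t + C * N x"
    and "locally_lipschitz_ae N T G"
  shows "\<exists>u. global_solution \<alpha> T G u0 u \<and>
           (\<forall>v. global_solution \<alpha> T G u0 v \<longrightarrow> (\<forall>t\<in>{0..T}. v t = u t))"
proof -
  let ?M = "lebesgue_on {0..T}"
  note T = \<open>T > 0\<close> and p = \<open>p > 1\<close> \<open>1 / p < \<alpha>\<close> \<open>\<alpha> < 1\<close>
  have p0: "0 \<le> p" using p by simp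
  have Gm: "\<And>x. (\<lambda>t. G t x) \<in> borel_measurable ?M" and Gc: "AE t in ?M. continuous_on UNIV (G t)"
    using assms(6) unfolding caratheodory_def by auto
  obtain a b where ab: "0 < a" "0 < b" "\<And>x. a * norm x \<le> N x" "\<And>x. N x \<le> b * norm x"
    by (rule is_norm_equivalent[OF assms(5)]) blast
  define g where "g = (\<lambda>s. (if s \<in> {0<..<T} then \<bar>\<gamma> s\<bar> / a else 0))"
  \<comment> \<open>The absolute value is taken because C may be negative.\<close>
  define c where "c = \<bar>C\<bar> * b / a"
  have g: "\<And>s. 0 \<le> g s" "g \<in> borel_measurable ?M" "integrable ?M (\<lambda>s. g s powr p)"
    using in_Lp_dominating[OF assms(7) ab(1)] ab(1) unfolding g_def by auto
  have c: "0 \<le> c" using ab by (simp add: c_def)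

  \<comment> \<open>The endpoints are excluded because \<open>g\<close> was set to 0 there.\<close>
  have "AE t in ?M. t \<noteq> 0" "AE t in ?M. t \<noteq> T" by (auto intro: AE_lebesgue_on_neq)
  then have growth: "AE t in ?M. \<forall>x. norm (G t x) \<le> g t + c * norm x"
    using assms(8) AE_space
  proof eventually_elim
    case (elim t)
    show ?case
    proof
      fix x
      have "a * norm (G t x) \<le> \<bar>\<gamma> t\<bar> + \<bar>C\<bar> * N x"
        using ab(3)[of "G t x"] elim(3)[rule_format, of x] mult_right_mono[OF abs_ge_self[of C], of "N x"]
          order_trans[OF mult_nonneg_nonneg[OF less_imp_le[OF ab(1)] norm_ge_zero] ab(3)[of x]] by linarith
      also have "\<dots> \<le> \<bar>\<gamma> t\<bar> + \<bar>C\<bar> * (b * norm x)"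
        by (intro add_left_mono mult_left_mono ab) simp
      finally have "norm (G t x) \<le> (\<bar>\<gamma> t\<bar> + \<bar>C\<bar> * (b * norm x)) / a"
        using ab(1) by (simp add: field_simps)
      also have "\<dots> = g t + c * norm x"
        using elim by (simp add: g_def c_def add_divide_distrib)
      finally show "norm (G t x) \<le> g t + c * norm x" .
    qed
  qed
  \<comment> \<open>R comes before the Lipschitz constant and the projection, as both depend on it.
    The balls below have radius \<bar>R\<bar> to be nonempty whatever the sign of R.\<close>
  obtain R where R0: "\<forall>u h. continuous_on {0..T} u \<longrightarrow> h \<in> borel_measurable ?M \<longrightarrow>
     (\<forall>s\<in>{0..T}. norm (h s) \<le> g s + c * norm (u s)) \<longrightarrow>
     (\<forall>t\<in>{0..T}. u t = u0 + rl_integral \<alpha> h t) \<longrightarrow> (\<forall>t\<in>{0..T}. norm (u t) \<le> R)"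
    using volterra_a_priori_bound[OF T p g c, of u0] by blast
  have R: "norm (u t) \<le> R" if "continuous_on {0..T} u" "h \<in> borel_measurable ?M"
    "\<And>s. s \<in> {0..T} \<Longrightarrow> norm (h s) \<le> g s + c * norm (u s)"
    "\<And>t. t \<in> {0..T} \<Longrightarrow> u t = u0 + rl_integral \<alpha> h t" "t \<in> {0..T}" for u h t
    using R0 that by blast
  obtain L where L: "0 \<le> L"
    and lip: "AE t in ?M. \<forall>x\<in>cball 0 \<bar>R\<bar>. \<forall>y\<in>cball 0 \<bar>R\<bar>. norm (G t x - G t y) \<le> L * norm (x - y)"
    using locally_lipschitz_ae_cball[OF assms(5,9) Gc] by blast

  \<comment> \<open>Collecting the properties that hold almost everywhere leaves a single null set
    on which \<open>G\<close> has to be changed.\<close>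
  define P where "P = (\<lambda>t. continuous_on UNIV (G t) \<and> (\<forall>x. norm (G t x) \<le> g t + c * norm x) \<and>
    (\<forall>x\<in>cball 0 \<bar>R\<bar>. \<forall>y\<in>cball 0 \<bar>R\<bar>. norm (G t x - G t y) \<le> L * norm (x - y)))"
  have "AE t in ?M. P t" using Gc growth lip unfolding P_def by eventually_elim blast
  then obtain Z where Z: "{t \<in> space ?M. \<not> P t} \<subseteq> Z" "Z \<in> null_sets ?M"
    by (rule AE_E3) (auto simp: null_sets_def)
  \<comment> \<open>\<open>H\<close> has all properties of \<open>G\<close> for every \<open>t\<close>, and gives the same Volterra equation.\<close>
  define H where "H = (\<lambda>t x. if t \<in> Z then 0 else G t x)"
  have PZ: "P t" if "t \<in> {0..T}" "t \<notin> Z" for t using that Z(1) by auto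
  have Hm: "(\<lambda>t. H t x) \<in> borel_measurable ?M" for x
  proof -
    have "Z \<in> sets ?M" using Z(2) by (rule null_setsD2)
    then show ?thesis unfolding H_def using Gm[of x] by (intro measurable_If_set) auto
  qed
  have Hc: "continuous_on UNIV (H t)" if "t \<in> {0..T}" for t
    using PZ[OF that] unfolding P_def H_def by (cases "t \<in> Z") auto
  have Hg: "norm (H t x) \<le> g t + c * norm x" if "t \<in> {0..T}" for t x
    using PZ[OF that] g(1)[of t] c unfolding P_def H_def by (cases "t \<in> Z") auto
  have Hl: "norm (H t x - H t y) \<le> L * norm (x - y)"
    if "t \<in> {0..T}" "x \<in> cball 0 \<bar>R\<bar>" "y \<in> cball 0 \<bar>R\<bar>" for t x y
    using PZ[OF that(1)] that(2,3) L unfolding P_def H_def by (cases "t \<in> Z") auto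
  \<comment> \<open>The quantifier over x stands inside, so that x = u t can be inserted for any
    u.\<close>
  have HG: "AE t in ?M. \<forall>x. H t x = G t x"
    using AE_not_in[OF Z(2)] by eventually_elim (simp add: H_def)
  have NH: "(\<lambda>t. H t (u t)) \<in> borel_measurable ?M" "integrable ?M (\<lambda>t. norm (H t (u t)) powr p)"
    if "continuous_on {0..T} u" for u
    using nemytskii_powr_integrable[OF Hm Hc Hg p0 g(1,3) c that] by blast+

  have sol: "global_solution \<alpha> T G u0 u \<longleftrightarrow>
    continuous_on {0..T} u \<and> (\<forall>t\<in>{0..T}. u t = u0 + rl_integral \<alpha> (\<lambda>s. H s (u s)) t)" for u
  proof (cases "continuous_on {0..T} u")
    case True
    have "(AE t in ?M. caputo \<alpha> T u t = G t (u t)) \<longleftrightarrow> (AE t in ?M. caputo \<alpha> T u t = H t (u t))"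
    proof
      show "AE t in ?M. caputo \<alpha> T u t = H t (u t)" if "AE t in ?M. caputo \<alpha> T u t = G t (u t)"
        using that HG by eventually_elim simp
      show "AE t in ?M. caputo \<alpha> T u t = G t (u t)" if "AE t in ?M. caputo \<alpha> T u t = H t (u t)"
        using that HG by eventually_elim simp
    qed
    then have "global_solution \<alpha> T G u0 u \<longleftrightarrow>
      (\<forall>t\<in>{0..T}. u t = u 0 + rl_integral \<alpha> (\<lambda>s. H s (u s)) t) \<and> u 0 = u0"
      using volterra_equivalence[OF T p True NH[OF True]] True unfolding global_solution_def by blast
    moreover have "u 0 = u0" if "\<forall>t\<in>{0..T}. u t = u0 + rl_integral \<alpha> (\<lambda>s. H s (u s)) t"
      using bspec[OF that, of 0] T by (simp add: rl_integral_0)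
    ultimately show ?thesis using True by metis
  qed (simp add: global_solution_def)
  have bound: "u t \<in> cball 0 \<bar>R\<bar>"
    if "continuous_on {0..T} u" "\<forall>t\<in>{0..T}. u t = u0 + rl_integral \<alpha> (\<lambda>s. H s (u s)) t" "t \<in> {0..T}" for u t
  proof -
    have "norm (u t) \<le> R"
      by (rule R[OF that(1) NH(1)[OF that(1)] Hg bspec[OF that(2)] that(3)])
    then show ?thesis by simp
  qed

  \<comment> \<open>\<open>H t \<circ> Q\<close> is globally Lipschitz with unchanged growth, so its solution stays where \<open>Q\<close> is the identity.\<close>
  define Q where "Q = closest_point (cball (0 :: real^'m) \<bar>R\<bar>)"
  have Q: "Q x \<in> cball 0 \<bar>R\<bar>" for x
    unfolding Q_def by (rule closest_point_in_set) auto
  have Qself: "Q x = x" if "x \<in> cball 0 \<bar>R\<bar>" for x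
    unfolding Q_def using that by (rule closest_point_self)
  have Qlip: "norm (Q x - Q y) \<le> norm (x - y)" for x y
    unfolding Q_def dist_norm[symmetric] by (rule closest_point_lipschitz) auto
  have Qnorm: "norm (Q x) \<le> norm x" for x
    using Qlip[of x 0] Qself[of 0] by simp
  have HQ: "norm (H t (Q x)) \<le> g t + c * norm x" if "t \<in> {0..T}" for t x
    using Hg[OF that, of "Q x"] mult_left_mono[OF Qnorm[of x] c] by linarith
  have "\<exists>u. continuous_on {0..T} u \<and> (\<forall>t\<in>{0..T}. u t = u0 + rl_integral \<alpha> (\<lambda>s. H s (Q (u s))) t)"
  proof (rule lipschitz_volterra_exists[OF T p _ _ L HQ g(1,3) c])
    show "norm (H t (Q x) - H t (Q y)) \<le> L * norm (x - y)" if "t \<in> {0..T}" for t x y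
      using Hl[OF that Q Q, of x y] mult_left_mono[OF Qlip[of x y] L] by linarith
  qed (rule Hm)
  then obtain u where u: "continuous_on {0..T} u" "\<forall>t\<in>{0..T}. u t = u0 + rl_integral \<alpha> (\<lambda>s. H s (Q (u s))) t"
    by blast
  have Qc: "continuous_on UNIV Q"
    by (rule lipschitz_on_continuous_on[OF lipschitz_onI[of _ _ 1]]) (auto simp: dist_norm Qlip)
  have HQm: "(\<lambda>s. H s (Q (u s))) \<in> borel_measurable ?M"
    by (rule NH(1)) (rule continuous_on_compose2[OF Qc u(1)], simp)
  have "u t \<in> cball 0 \<bar>R\<bar>" if "t \<in> {0..T}" for t
  proof -
    have "norm (u t) \<le> R" by (rule R[OF u(1) HQm HQ bspec[OF u(2)] that])
    then show ?thesis by simp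
  qed
  then have uH: "\<forall>t\<in>{0..T}. u t = u0 + rl_integral \<alpha> (\<lambda>s. H s (u s)) t"
    using u(2) Qself rl_integral_cong[where T = T and f = "\<lambda>s. H s (Q (u s))" and h = "\<lambda>s. H s (u s)"] by simp
  show ?thesis
  proof (intro exI conjI allI impI ballI)
    show "global_solution \<alpha> T G u0 u" using sol u(1) uH by blast
    fix v t assume "global_solution \<alpha> T G u0 v" and t: "t \<in> {0..T}"
    then have v: "continuous_on {0..T} v" "\<forall>t\<in>{0..T}. v t = u0 + rl_integral \<alpha> (\<lambda>s. H s (v s)) t"
      using sol by blast+
    show "v t = u t"
    proof (rule volterra_unique[OF T p v(1) bspec[OF v(2)] NH[OF v(1)] u(1) bspec[OF uH] NH[OF u(1)] _ L t])
      \<comment> \<open>Both solutions stay in the ball of radius \<bar>R\<bar>, so the Lipschitz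
        estimate on that ball applies to \<open>H\<close> itself.\<close>
      show "norm (H s (v s) - H s (u s)) \<le> L * norm (v s - u s)" if "s \<in> {0..T}" for s
        using Hl[OF that bound[OF v that] bound[OF u(1) uH that]] .
    qed
  qed
qed

end
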